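(* All trees on $n$ vertices are maximal elements in the poset $\mathcal{E}_n$.
   Context: All graphs are finite and simple. The chromatic symmetric function of a graph $G$ with vertices $v_1,\dots,v_n$ is $X_G=\sum_{\kappa}x_{\kappa(v_1)}\cdots x_{\kappa(v_n)}$, summed over all proper colorings $\kappa:V(G)\to\{1,2,3,\dots\}$; it is a homogeneous symmetric function of degree $n$ over $\mathbb{Q}$. Let $e_\lambda=e_{\lambda_1}e_{\lambda_2}\cdots$ be the elementary symmetric functions; $[e_\lambda]F$ denotes the coefficient of $e_\lambda$ in $F$ expanded in this basis, and $F$ is $e$-positive if $[e_\lambda]F\ge 0$ for all $\lambda$. For connected graphs $G,H$ on $n$ vertices (for which $[e_{(n)}]X_G$ and $[e_{(n)}]X_H$ are positive), set $$X_e(G,H)=X_G-\frac{[e_{(n)}]X_G}{[e_{(n)}]X_H}X_H.$$ $\mathcal{E}_n$ is the poset whose elements are the equivalence classes of connected graphs on $n$ vertices under $G\sim H\iff X_G=X_H$, ordered by $G\geq_e H$ if and only if $X_e(G,H)$ is $e$-positive. An element $x$ of a poset is maximal if $y\leq x$ for every $y$ comparable to $x$. *)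

theory Defs
  imports
    "HOL-Library.Multiset"
    "HOL-Library.FuncSet"
    "Graph_Theory.Graph_Theory"
begin

section \<open>Formal power series over the rationals in countably many variables\<close>

text \<open>
  The variables are \<open>x\<^sub>i\<close> with \<open>i :: nat\<close>, so colours start at 0 instead of 1. A monomial is the
  finite multiset of the indices of its variables, and a series is the family of its coefficients.
\<close>

typedef xseries = "UNIV :: (nat multiset \<Rightarrow> rat) set"
  morphisms coeff_of Xseries ..

setup_lifting type_definition_xseries

definition splits :: "'a multiset \<Rightarrow> ('a multiset \<times> 'a multiset) set" where
  "splits m = {(a, b). a + b = m}"

lemma finite_splits: "finite (splits m)"
proof -
  have "finite {a. a \<subseteq># m}"
  proof (rule finite_subset)
    show "{a. a \<subseteq># m} \<subseteq> mset ` {xs. set xs \<subseteq> set_mset m \<and> length xs \<le> size m}"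
    proof
      fix a assume "a \<in> {a. a \<subseteq># m}"
      then have a: "set_mset a \<subseteq> set_mset m" "size a \<le> size m"
        by (auto dest: set_mset_mono size_mset_mono)
      obtain xs where xs: "mset xs = a"
        using ex_mset by blast
      have "set xs \<subseteq> set_mset m \<and> length xs \<le> size m"
        using a xs by auto
      then show "a \<in> mset ` {xs. set xs \<subseteq> set_mset m \<and> length xs \<le> size m}"
        using xs by blast
    qed
    show "finite (mset ` {xs. set xs \<subseteq> set_mset m \<and> length xs \<le> size m})"
      by (simp add: finite_lists_length_le)
  qed
  then have "finite ({a. a \<subseteq># m} \<times> {a. a \<subseteq># m})"
    by simp
  then show ?thesis
    by (rule rev_finite_subset) (auto simp: splits_def)
qed

instantiation xseries :: comm_ring_1
begin

lift_definition zero_xseries :: xseries is "\<lambda>_. 0" .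
lift_definition one_xseries :: xseries is "\<lambda>m. if m = {#} then 1 else 0" .
lift_definition plus_xseries :: "xseries \<Rightarrow> xseries \<Rightarrow> xseries" is "\<lambda>f g m. f m + g m" .
lift_definition minus_xseries :: "xseries \<Rightarrow> xseries \<Rightarrow> xseries" is "\<lambda>f g m. f m - g m" .
lift_definition uminus_xseries :: "xseries \<Rightarrow> xseries" is "\<lambda>f m. - f m" .
lift_definition times_xseries :: "xseries \<Rightarrow> xseries \<Rightarrow> xseries"
  is "\<lambda>f g m. \<Sum>(a, b) \<in> splits m. f a * g b" .

instance
proof
  fix f g h :: xseries
  show "f * g * h = f * (g * h)"
  proof transfer
    fix f g h :: "nat multiset \<Rightarrow> rat"
    have "(\<Sum>(a, b)\<in>splits m. (\<Sum>(c, d)\<in>splits a. f c * g d) * h b) =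
          (\<Sum>(a, b)\<in>splits m. f a * (\<Sum>(c, d)\<in>splits b. g c * h d))" for m
    proof -
      have "(\<Sum>(a, b)\<in>splits m. (\<Sum>(c, d)\<in>splits a. f c * g d) * h b) =
            (\<Sum>p\<in>splits m. \<Sum>q\<in>splits (fst p). f (fst q) * g (snd q) * h (snd p))"
        by (simp add: sum_distrib_right case_prod_beta)
      also have "\<dots> = (\<Sum>(p, q)\<in>Sigma (splits m) (\<lambda>p. splits (fst p)).
          f (fst q) * g (snd q) * h (snd p))"
        by (rule sum.Sigma) (auto simp: finite_splits)
      also have "\<dots> = (\<Sum>(p, q)\<in>Sigma (splits m) (\<lambda>p. splits (snd p)).
          f (fst p) * g (fst q) * h (snd q))"
        by (rule sum.reindex_bij_witness
              [where i = "\<lambda>(p, q). ((fst p + fst q, snd q), (fst p, fst q))"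
                 and j = "\<lambda>(p, q). ((fst q, snd q + snd p), (snd q, snd p))"])
           (auto simp: splits_def algebra_simps)
      also have "\<dots> = (\<Sum>p\<in>splits m. \<Sum>q\<in>splits (snd p). f (fst p) * g (fst q) * h (snd q))"
        by (rule sum.Sigma [symmetric]) (auto simp: finite_splits)
      also have "\<dots> = (\<Sum>(a, b)\<in>splits m. f a * (\<Sum>(c, d)\<in>splits b. g c * h d))"
        by (simp add: sum_distrib_left case_prod_beta mult.assoc)
      finally show ?thesis .
    qed
    then show "(\<lambda>m. \<Sum>(a, b)\<in>splits m. (\<Sum>(a, b)\<in>splits a. f a * g b) * h b) =
        (\<lambda>m. \<Sum>(a, b)\<in>splits m. f a * (\<Sum>(a, b)\<in>splits b. g a * h b))"
      by simp
  qed
  show "f * g = g * f"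
  proof transfer
    fix f g :: "nat multiset \<Rightarrow> rat"
    have "(\<Sum>(a, b)\<in>splits m. f a * g b) = (\<Sum>(a, b)\<in>splits m. g a * f b)" for m
      by (rule sum.reindex_bij_witness [where i = prod.swap and j = prod.swap])
         (auto simp: splits_def ac_simps)
    then show "(\<lambda>m. \<Sum>(a, b)\<in>splits m. f a * g b) = (\<lambda>m. \<Sum>(a, b)\<in>splits m. g a * f b)"
      by simp
  qed
  show "1 * f = f"
  proof transfer
    fix f :: "nat multiset \<Rightarrow> rat"
    have "(\<Sum>(a, b)\<in>splits m. (if a = {#} then 1 else 0) * f b) = f m" for m
    proof -
      have "(\<Sum>(a, b)\<in>splits m. (if a = {#} then 1 else 0) * f b) =
            (\<Sum>(a, b)\<in>{({#} :: nat multiset, m)}. (if a = {#} then 1 else 0) * f b)"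
        by (intro sum.mono_neutral_right ballI)
           (auto simp: finite_splits, auto simp: splits_def split: if_splits)
      then show ?thesis by simp
    qed
    then show "(\<lambda>m. \<Sum>(a, b)\<in>splits m. (if a = {#} then 1 else 0) * f b) = f"
      by simp
  qed
  show "(f + g) * h = f * h + g * h"
    by transfer (simp add: case_prod_beta ring_distribs sum.distrib)
  show "f + g + h = f + (g + h)" "f + g = g + f" "0 + f = f" "- f + f = 0" "f - g = f + - g"
    by (transfer, simp add: algebra_simps)+
  show "(0 :: xseries) \<noteq> 1"
    by transfer (auto dest: fun_cong [where x = "{#}"])
qed

end

lift_definition series_scale :: "rat \<Rightarrow> xseries \<Rightarrow> xseries" is "\<lambda>c f m. c * f m" .

section \<open>Elementary symmetric functions\<close>

text \<open>The sum of all squarefree monomials of degree \<open>k\<close>.\<close>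

lift_definition elem_sym :: "nat \<Rightarrow> xseries"
  is "\<lambda>k m. if size m = k \<and> (\<forall>i. count m i \<le> 1) then 1 else 0" .

text \<open>An integer partition is the multiset of its parts, all of which are positive.\<close>

definition is_partition :: "nat multiset \<Rightarrow> bool" where
  "is_partition la \<longleftrightarrow> 0 \<notin># la"

definition elem_sym_part :: "nat multiset \<Rightarrow> xseries" where
  "elem_sym_part la = (\<Prod>k\<in>#la. elem_sym k)"

definition e_expansion :: "xseries \<Rightarrow> (nat multiset \<Rightarrow> rat) \<Rightarrow> bool" where
  "e_expansion F c \<longleftrightarrow>
     finite {la. c la \<noteq> 0} \<and> (\<forall>la. c la \<noteq> 0 \<longrightarrow> is_partition la) \<and>
     F = (\<Sum>la | c la \<noteq> 0. series_scale (c la) (elem_sym_part la))"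

text \<open>
  Every symmetric function has exactly one such expansion, so the description is proper on
  symmetric functions; no meaning is attached to it on other series.
\<close>

definition e_coeff :: "nat multiset \<Rightarrow> xseries \<Rightarrow> rat" where
  "e_coeff la F = (THE c. e_expansion F c) la"

definition e_positive :: "xseries \<Rightarrow> bool" where
  "e_positive F \<longleftrightarrow> (\<forall>la. is_partition la \<longrightarrow> e_coeff la F \<ge> 0)"

section \<open>Graphs and the chromatic symmetric function\<close>

text \<open>
  A finite simple graph is a \<open>pair_graph\<close>: a finite loopless symmetric digraph without parallel
  arcs, in which the edge \<open>uv\<close> is represented by the two arcs \<open>(u, v)\<close> and \<open>(v, u)\<close>.
\<close>

text \<open>
  Colourings are extensional functions on the vertex set, so that each is counted once.
\<close>

definition proper_colorings :: "'a pair_pre_digraph \<Rightarrow> ('a \<Rightarrow> nat) set" where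
  "proper_colorings G =
     {\<kappa> \<in> pverts G \<rightarrow>\<^sub>E UNIV. \<forall>(u, v) \<in> parcs G. \<kappa> u \<noteq> \<kappa> v}"

text \<open>
  The coefficient of a monomial counts the proper colourings \<open>\<kappa>\<close> for which the product of the
  \<open>x\<^bsub>\<kappa>(v)\<^esub>\<close> over all vertices \<open>v\<close> is this monomial.
\<close>

definition chrom_sym :: "'a pair_pre_digraph \<Rightarrow> xseries" where
  "chrom_sym G = Xseries (\<lambda>m.
     of_nat (card {\<kappa> \<in> proper_colorings G. image_mset \<kappa> (mset_set (pverts G)) = m}))"

definition X_e :: "'a pair_pre_digraph \<Rightarrow> 'a pair_pre_digraph \<Rightarrow> xseries" where
  "X_e G H = chrom_sym G -
     series_scale (e_coeff {#card (pverts G)#} (chrom_sym G) / e_coeff {#card (pverts H)#} (chrom_sym H))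
       (chrom_sym H)"

definition connected_graphs :: "nat \<Rightarrow> 'a pair_pre_digraph set" where
  "connected_graphs n =
     {G. pair_graph G \<and> Digraph_Component.connected (with_proj G) \<and> card (pverts G) = n}"

text \<open>
  The library predicates \<open>forest\<close> and \<open>tree\<close> are meant for orientations: in a symmetric digraph
  they count the two arcs of any edge as a cycle of length 2. A cycle of the underlying simple
  graph is a cycle of length at least 3.
\<close>

definition is_tree :: "'a pair_pre_digraph \<Rightarrow> bool" where
  "is_tree G \<longleftrightarrow> pair_graph G \<and> Digraph_Component.connected (with_proj G) \<and>
     \<not> (\<exists>p. pre_digraph.cycle (with_proj G) p \<and> length p \<ge> 3)"

section \<open>The poset of connected graphs on \<open>n\<close> vertices\<close>

definition chrom_equiv :: "nat \<Rightarrow> 'a pair_pre_digraph rel" where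
  "chrom_equiv n =
     {(G, H). G \<in> connected_graphs n \<and> H \<in> connected_graphs n \<and> chrom_sym G = chrom_sym H}"

lemma equiv_chrom_equiv: "equiv (connected_graphs n) (chrom_equiv n)"
  by (rule equivI) (auto simp: chrom_equiv_def refl_on_def sym_def trans_def)

definition E_poset :: "nat \<Rightarrow> 'a pair_pre_digraph set set" where
  "E_poset n = connected_graphs n // chrom_equiv n"

text \<open>
  On two graphs with the same number of vertices, \<open>X_e\<close> depends only on their chromatic symmetric
  functions, so the choice of representatives does not matter.
\<close>

definition E_le :: "'a pair_pre_digraph set \<Rightarrow> 'a pair_pre_digraph set \<Rightarrow> bool" where
  "E_le A B \<longleftrightarrow> (\<exists>H \<in> A. \<exists>G \<in> B. e_positive (X_e G H))"

lemma E_le_classes: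
  assumes "G \<in> connected_graphs n" "H \<in> connected_graphs n"
  shows "E_le (chrom_equiv n `` {H}) (chrom_equiv n `` {G}) \<longleftrightarrow> e_positive (X_e G H)"
  using assms unfolding E_le_def chrom_equiv_def X_e_def
  by (auto simp: connected_graphs_def)

definition maximal_in :: "'b set \<Rightarrow> ('b \<Rightarrow> 'b \<Rightarrow> bool) \<Rightarrow> 'b \<Rightarrow> bool" where
  "maximal_in P le x \<longleftrightarrow> x \<in> P \<and> (\<forall>y \<in> P. le x y \<or> le y x \<longrightarrow> le y x)"

end

theory Submission
  imports Defs
begin

text \<open>
  Let \<open>\<phi>\<close> be the ring homomorphism sending each \<open>e\<^sub>k\<close> to 1, so that \<open>\<phi> F\<close> is the sum of the \<open>e\<close>-coefficients
  of \<open>F\<close>. Deletion-contraction, applied to weighted graphs in order to have contractions at hand, shows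
  for connected \<open>G\<close> on \<open>n\<close> vertices that \<open>[e\<^bsub>(n)\<^esub>] X\<^sub>G = n \<alpha>\<close> and \<open>\<phi> X\<^sub>G \<le> 2\<^bsup>n - 1\<^esup> \<alpha>\<close> with \<open>\<alpha> \<ge> 1\<close>,
  with equality when \<open>G\<close> is a tree. (In Stanley's terms these count acyclic orientations with one sink
  and all acyclic orientations.) Hence \<open>\<phi> (X\<^sub>e G T) \<le> 0\<close> for every tree \<open>T\<close>; if \<open>X\<^sub>e G T\<close> is \<open>e\<close>-positive
  it must then vanish, so \<open>X\<^sub>G\<close> is a multiple of \<open>X\<^sub>T\<close> and \<open>X\<^sub>e T G\<close> vanishes as well.
\<close>

section \<open>Uniqueness of the expansion in elementary symmetric functions\<close>

lemma xseries_eqI: "(\<And>m. coeff_of F m = coeff_of G m) \<Longrightarrow> F = G"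
  by (metis coeff_of_inverse ext)

lemma coeff_of_sum: "coeff_of (sum f A) m = (\<Sum>x\<in>A. coeff_of (f x) m)"
  by (induction A rule: infinite_finite_induct) (auto simp: zero_xseries.rep_eq plus_xseries.rep_eq)

lemma series_scale_0 [simp]: "series_scale 0 F = 0"
  by transfer simp

lemma series_scale_1 [simp]: "series_scale 1 F = F"
  by transfer simp

lemma series_scale_zero [simp]: "series_scale c 0 = 0"
  by transfer simp

lemma series_scale_add: "series_scale (c + d) F = series_scale c F + series_scale d F"
  by transfer (simp add: algebra_simps)

lemma series_scale_add_right: "series_scale c (F + G) = series_scale c F + series_scale c G"
  by transfer (simp add: algebra_simps)

lemma series_scale_scale: "series_scale c (series_scale d F) = series_scale (c * d) F"
  by transfer (simp add: algebra_simps)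

lemma series_scale_minus_one: "series_scale (- 1) F = - F"
  by transfer simp

lemma mult_series_scale: "F * series_scale c G = series_scale c (F * G)"
  by transfer (auto simp: sum_distrib_left intro!: sum.cong)

lemma elem_sym_part_empty [simp]: "elem_sym_part {#} = 1"
  by (simp add: elem_sym_part_def)

lemma elem_sym_part_add: "elem_sym_part (la + mu) = elem_sym_part la * elem_sym_part mu"
  by (simp add: elem_sym_part_def)

text \<open>
  If \<open>x\<^sub>i\<close> has weight \<open>i\<close>, then \<open>e\<^sub>\<lambda>\<close> has a unique monomial of least weight, and it determines \<open>\<lambda>\<close>.
\<close>

definition lowest_mon :: "nat multiset \<Rightarrow> nat multiset" where
  "lowest_mon la = (\<Sum>k\<in>#la. mset_set {..<k})"

text \<open>The exponents are the parts of the conjugate partition, since \<open>x_i\<close> occurs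
  in the factor for \<open>k\<close> exactly when \<open>i < k\<close>.\<close>

lemma count_lowest_mon: "count (lowest_mon la) i = size (filter_mset (\<lambda>k. i < k) la)"
  by (induction la) (auto simp: lowest_mon_def count_mset_set')

text \<open>The difference of two consecutive exponents counts the parts equal to
  \<open>Suc i\<close>. A part 0 would leave no trace in \<open>lowest_mon\<close>;
  \<open>is_partition\<close> excludes it.\<close>

lemma inj_lowest_mon:
  assumes "is_partition la" "is_partition mu" "lowest_mon la = lowest_mon mu"
  shows "la = mu"
proof (rule multiset_eqI)
  fix k
  have gt: "size (filter_mset (\<lambda>k. i < k) la) = size (filter_mset (\<lambda>k. i < k) mu)" for i
    using assms(3) by (metis count_lowest_mon)
  show "count la k = count mu k"
  proof (cases k)
    case 0
    then show ?thesis
      using assms by (simp add: is_partition_def not_in_iff)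
  next
    case (Suc i)
    have split: "size (filter_mset (\<lambda>k. i < k) nu)
        = count nu (Suc i) + size (filter_mset (\<lambda>k. Suc i < k) nu)" for nu
      by (induction nu) auto
    show ?thesis
      using gt[of i] gt[of "Suc i"] split[of la] split[of mu] Suc by simp
  qed
qed

text \<open>Induction on \<open>k\<close>, removing the maximum \<open>M\<close> of
  \<open>S\<close>: a set of \<open>Suc k\<close> elements inside \<open>{..M}\<close> forces
  \<open>k \<le> M\<close>.\<close>

lemma sum_lessThan_le_sum:
  fixes S :: "nat set"
  assumes "finite S" "card S = k"
  shows "\<Sum>{..<k} \<le> \<Sum>S" and "\<Sum>S = \<Sum>{..<k} \<Longrightarrow> S = {..<k}"
proof -
  have "\<Sum>{..<k} \<le> \<Sum>S \<and> (\<Sum>S = \<Sum>{..<k} \<longrightarrow> S = {..<k})"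
    using assms
  proof (induction k arbitrary: S)
    case (Suc k)
    define M where "M = Max S"
    have ne: "S \<noteq> {}" using Suc.prems by auto
    then have M: "M \<in> S" using Suc.prems by (auto simp: M_def)
    have "S \<subseteq> {..M}" using Suc.prems by (auto simp: M_def)
    then have "card S \<le> card {..M}" by (intro card_mono) auto
    then have "k \<le> M" using Suc.prems by simp
    have sum: "\<Sum>S = M + \<Sum>(S - {M})"
      using M Suc.prems by (simp add: sum.remove)
    have IH: "\<Sum>{..<k} \<le> \<Sum>(S - {M})" "\<Sum>(S - {M}) = \<Sum>{..<k} \<longrightarrow> S - {M} = {..<k}"
      using Suc.IH[of "S - {M}"] Suc.prems M by auto
    have "S = {..<Suc k}" if "\<Sum>S = \<Sum>{..<Suc k}"
    proof -
      have "M = k" "\<Sum>(S - {M}) = \<Sum>{..<k}"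
        using that sum IH(1) \<open>k \<le> M\<close> by auto
      then have "S - {M} = {..<k}" using IH(2) by blast
      then show ?thesis using M \<open>M = k\<close> by (metis insert_Diff lessThan_Suc)
    qed
    then show ?case using sum IH(1) \<open>k \<le> M\<close> by auto
  qed auto
  then show "\<Sum>{..<k} \<le> \<Sum>S" "\<Sum>S = \<Sum>{..<k} \<Longrightarrow> S = {..<k}" by auto
qed

lemma squarefree_mset_set: "(\<forall>i. count m i \<le> 1) \<Longrightarrow> m = mset_set (set_mset m)"
  by (metis One_nat_def count_mset_set(1,3) finite_set_mset le_Suc_eq le_zero_eq multiset_eqI not_in_iff)

text \<open>Nonzero coefficients belong to sets of \<open>k\<close> variables. With
  \<open>x_i\<close> of weight \<open>i\<close>, the weight of a monomial is the sum over its
  set.\<close>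

lemma elem_sym_lowest:
  assumes "coeff_of (elem_sym k) m \<noteq> 0"
  shows "\<Sum>{..<k} \<le> \<Sum>\<^sub># m" and "\<Sum>\<^sub># m = \<Sum>{..<k} \<Longrightarrow> m = mset_set {..<k}"
proof -
  have *: "size m = k" "\<forall>i. count m i \<le> 1"
    using assms by (auto simp: elem_sym.rep_eq split: if_splits)
  note m = squarefree_mset_set[OF *(2)]
  have card: "card (set_mset m) = k" using *(1) m by (metis size_mset_set)
  have sum: "\<Sum>\<^sub># m = \<Sum>(set_mset m)" by (subst m) (simp add: sum_unfold_sum_mset)
  show "\<Sum>{..<k} \<le> \<Sum>\<^sub># m" "\<Sum>\<^sub># m = \<Sum>{..<k} \<Longrightarrow> m = mset_set {..<k}"
    using sum_lessThan_le_sum[OF _ card] sum m by auto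
qed

text \<open>Weight is additive over products, so a split of a monomial of least weight has least
  weight in each factor. Hence a single split contributes to the coefficient of
  \<open>lowest_mon la\<close>.\<close>

lemma elem_sym_part_lowest:
  shows "coeff_of (elem_sym_part la) m \<noteq> 0 \<Longrightarrow> \<Sum>\<^sub># (lowest_mon la) \<le> \<Sum>\<^sub># m"
    and "coeff_of (elem_sym_part la) m \<noteq> 0 \<Longrightarrow> \<Sum>\<^sub># m = \<Sum>\<^sub># (lowest_mon la) \<Longrightarrow> m = lowest_mon la"
    and "coeff_of (elem_sym_part la) (lowest_mon la) = 1"
proof -
  have "(\<forall>m. coeff_of (elem_sym_part la) m \<noteq> 0 \<longrightarrow> \<Sum>\<^sub># (lowest_mon la) \<le> \<Sum>\<^sub># m
         \<and> (\<Sum>\<^sub># m = \<Sum>\<^sub># (lowest_mon la) \<longrightarrow> m = lowest_mon la))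
      \<and> coeff_of (elem_sym_part la) (lowest_mon la) = 1"
  proof (induction la)
    case empty
    then show ?case by (auto simp: lowest_mon_def one_xseries.rep_eq)
  next
    case (add k la)
    have low: "lowest_mon (add_mset k la) = mset_set {..<k} + lowest_mon la"
      by (simp add: lowest_mon_def)
    have wt: "\<Sum>\<^sub># (lowest_mon (add_mset k la)) = \<Sum>{..<k} + \<Sum>\<^sub># (lowest_mon la)"
      by (simp add: low sum_unfold_sum_mset)
    have prod: "coeff_of (elem_sym_part (add_mset k la)) m
        = (\<Sum>(a, b)\<in>splits m. coeff_of (elem_sym k) a * coeff_of (elem_sym_part la) b)" for m
      by (simp add: elem_sym_part_def times_xseries.rep_eq)
    have fact: "\<Sum>\<^sub># (lowest_mon (add_mset k la)) \<le> \<Sum>\<^sub># m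
         \<and> (\<Sum>\<^sub># m = \<Sum>\<^sub># (lowest_mon (add_mset k la)) \<longrightarrow> a = mset_set {..<k} \<and> b = lowest_mon la)"
      if "(a, b) \<in> splits m" "coeff_of (elem_sym k) a * coeff_of (elem_sym_part la) b \<noteq> 0" for a b m
    proof -
      have "coeff_of (elem_sym k) a \<noteq> 0" "coeff_of (elem_sym_part la) b \<noteq> 0" "m = a + b"
        using that by (auto simp: splits_def)
      moreover note elem_sym_lowest[OF this(1)] add.IH[THEN conjunct1, rule_format, OF this(2)]
      ultimately show ?thesis by (auto simp: wt)
    qed
    have "\<Sum>\<^sub># (lowest_mon (add_mset k la)) \<le> \<Sum>\<^sub># m
         \<and> (\<Sum>\<^sub># m = \<Sum>\<^sub># (lowest_mon (add_mset k la)) \<longrightarrow> m = lowest_mon (add_mset k la))"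
      if nz: "coeff_of (elem_sym_part (add_mset k la)) m \<noteq> 0" for m
    proof -
      obtain a b where ab: "(a, b) \<in> splits m"
          "coeff_of (elem_sym k) a * coeff_of (elem_sym_part la) b \<noteq> 0"
        using nz unfolding prod by (auto elim!: sum.not_neutral_contains_not_neutral)
      then have "m = a + b" by (simp add: splits_def)
      with fact[OF ab] show ?thesis by (auto simp: low)
    qed
    moreover have "coeff_of (elem_sym_part (add_mset k la)) (lowest_mon (add_mset k la)) = 1"
    proof -
      let ?m = "lowest_mon (add_mset k la)"
      have "coeff_of (elem_sym_part (add_mset k la)) ?m
          = (\<Sum>(a, b)\<in>{(mset_set {..<k}, lowest_mon la)}.
              coeff_of (elem_sym k) a * coeff_of (elem_sym_part la) b)"
        unfolding prod
      proof (rule sum.mono_neutral_right[OF finite_splits])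
        show "{(mset_set {..<k}, lowest_mon la)} \<subseteq> splits ?m"
          by (simp add: low splits_def)
        show "\<forall>p\<in>splits ?m - {(mset_set {..<k}, lowest_mon la)}.
            (case p of (a, b) \<Rightarrow> coeff_of (elem_sym k) a * coeff_of (elem_sym_part la) b) = 0"
          using fact[of _ _ ?m] by fastforce
      qed
      also have "\<dots> = 1"
        using add.IH by (simp add: elem_sym.rep_eq count_mset_set')
      finally show ?thesis .
    qed
    ultimately show ?case by blast
  qed
  then show "coeff_of (elem_sym_part la) m \<noteq> 0 \<Longrightarrow> \<Sum>\<^sub># (lowest_mon la) \<le> \<Sum>\<^sub># m"
    "coeff_of (elem_sym_part la) m \<noteq> 0 \<Longrightarrow> \<Sum>\<^sub># m = \<Sum>\<^sub># (lowest_mon la) \<Longrightarrow> m = lowest_mon la"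
    "coeff_of (elem_sym_part la) (lowest_mon la) = 1"
    by auto
qed

text \<open>Among the partitions with nonzero coefficient let \<open>mu\<close> be one whose lowest
  monomial has least weight. No other term with nonzero coefficient contains this monomial, so its
  coefficient in the sum is \<open>c mu\<close>.\<close>

lemma elem_sym_part_independent:
  assumes fin: "finite S" and part: "\<And>la. la \<in> S \<Longrightarrow> is_partition la"
    and zero: "(\<Sum>la\<in>S. series_scale (c la) (elem_sym_part la)) = 0"
    and "la \<in> S"
  shows "c la = 0"
proof (rule ccontr)
  assume "c la \<noteq> 0"
  define S' where "S' = {la \<in> S. c la \<noteq> 0}"
  have "finite S'" "S' \<noteq> {}" using fin \<open>la \<in> S\<close> \<open>c la \<noteq> 0\<close> by (auto simp: S'_def)
  then obtain mu where mu: "mu \<in> S'"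
      and min: "\<And>nu. nu \<in> S' \<Longrightarrow> \<Sum>\<^sub># (lowest_mon mu) \<le> \<Sum>\<^sub># (lowest_mon nu)"
    using arg_min_if_finite[of S' "\<lambda>nu. \<Sum>\<^sub># (lowest_mon nu)"] by (metis not_less)
  have "c nu * coeff_of (elem_sym_part nu) (lowest_mon mu) = 0" if nu: "nu \<in> S - {mu}" for nu
  proof (rule ccontr)
    assume nz: "c nu * coeff_of (elem_sym_part nu) (lowest_mon mu) \<noteq> 0"
    then have "nu \<in> S'" using nu by (auto simp: S'_def)
    have "lowest_mon mu = lowest_mon nu"
      using elem_sym_part_lowest(1,2)[of nu "lowest_mon mu"] min[OF \<open>nu \<in> S'\<close>] nz by simp
    then show False
      using inj_lowest_mon[of mu nu] part mu nu by (auto simp: S'_def)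
  qed
  then have "(\<Sum>nu\<in>S. c nu * coeff_of (elem_sym_part nu) (lowest_mon mu))
      = (\<Sum>nu\<in>{mu}. c nu * coeff_of (elem_sym_part nu) (lowest_mon mu))"
    using fin mu by (intro sum.mono_neutral_right) (auto simp: S'_def)
  also have "\<dots> = c mu" by (simp add: elem_sym_part_lowest(3))
  finally show False
    using arg_cong[OF zero, of "\<lambda>F. coeff_of F (lowest_mon mu)"] mu
    by (simp add: coeff_of_sum series_scale.rep_eq zero_xseries.rep_eq S'_def)
qed

lemma e_expansion_unique:
  assumes c: "e_expansion F c" and d: "e_expansion F d"
  shows "c = d"
proof
  fix la
  let ?S = "{la. c la \<noteq> 0} \<union> {la. d la \<noteq> 0}"
  have ext: "F = (\<Sum>la\<in>?S. series_scale (b la) (elem_sym_part la))"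
    if "e_expansion F b" "{la. b la \<noteq> 0} \<subseteq> ?S" for b
    using that c d unfolding e_expansion_def
    by (auto intro!: sum.mono_neutral_left)
  have "(\<Sum>la\<in>?S. series_scale (c la - d la) (elem_sym_part la))
      = (\<Sum>la\<in>?S. series_scale (c la) (elem_sym_part la))
        - (\<Sum>la\<in>?S. series_scale (d la) (elem_sym_part la))"
    by (rule xseries_eqI)
       (simp add: coeff_of_sum minus_xseries.rep_eq series_scale.rep_eq sum_subtractf algebra_simps)
  also have "\<dots> = 0" using ext[OF c] ext[OF d] by auto
  finally have "c la - d la = 0" if "la \<in> ?S"
    using that c d by (intro elem_sym_part_independent[of ?S "\<lambda>la. c la - d la"]) (auto simp: e_expansion_def)
  then show "c la = d la" by (cases "la \<in> ?S") auto
qed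

text \<open>By uniqueness, any expansion at hand meets the definite description in
  \<open>e_coeff\<close>.\<close>

lemma e_coeff_eq: "e_expansion F c \<Longrightarrow> e_coeff la F = c la"
  unfolding e_coeff_def by (metis e_expansion_unique the_equality)

section \<open>Two functionals on the span of the elementary symmetric functions\<close>

text \<open>
  The argument \<open>s\<close> is the sum of all coefficients of \<open>F\<close>, i.e. its image under the ring
  homomorphism sending each \<open>e\<^sub>k\<close> to 1; \<open>z\<close> and \<open>a\<close> are the coefficients at the empty
  partition and at \<open>(n)\<close>.
\<close>

inductive e_span :: "nat \<Rightarrow> xseries \<Rightarrow> rat \<Rightarrow> rat \<Rightarrow> rat \<Rightarrow> bool" for n where
  zero: "e_span n 0 0 0 0"
| add_term: "e_span n F s z a \<Longrightarrow> is_partition la \<Longrightarrow>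
    e_span n (F + series_scale q (elem_sym_part la)) (s + q)
      (z + (if la = {#} then q else 0)) (a + (if la = {#n#} then q else 0))"

lemma e_span_add: "e_span n G s' z' a' \<Longrightarrow> e_span n F s z a \<Longrightarrow> e_span n (F + G) (s + s') (z + z') (a + a')"
proof (induction rule: e_span.induct)
  case (add_term G s' z' a' la q)
  from e_span.add_term[OF add_term.IH[OF add_term.prems] add_term.hyps(2), of q]
  show ?case by (simp add: add.assoc)
qed auto

lemma e_span_scale: "e_span n F s z a \<Longrightarrow> e_span n (series_scale c F) (c * s) (c * z) (c * a)"
proof (induction rule: e_span.induct)
  case (add_term F s z a la q)
  from e_span.add_term[OF add_term.IH add_term.hyps(2), of "c * q"]
  show ?case
    by (simp only: series_scale_add_right series_scale_scale distrib_left if_distrib[of "(*) c"] mult_zero_right)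
qed (auto intro: e_span.zero)

lemma e_span_diff:
  assumes "e_span n F s z a" "e_span n G s' z' a'"
  shows "e_span n (F - G) (s - s') (z - z') (a - a')"
  using e_span_add[OF e_span_scale[OF assms(2), of "- 1"] assms(1)]
  by (simp add: series_scale_minus_one)

lemma e_span_sum:
  "(\<And>x. x \<in> A \<Longrightarrow> e_span n (F x) (s x) (z x) (a x)) \<Longrightarrow> e_span n (sum F A) (sum s A) (sum z A) (sum a A)"
proof (induction A rule: infinite_finite_induct)
  case (insert x A)
  then show ?case using e_span_add[of n "sum F A" "sum s A" "sum z A" "sum a A"] by simp
qed (auto intro: e_span.zero)

lemma e_span_mult_part:
  assumes "e_span n F s z a" "is_partition la" "n \<noteq> 0"
  shows "e_span n (F * elem_sym_part la) s (if la = {#} then z else 0)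
    (if la = {#} then a else if la = {#n#} then z else 0)"
  using assms(1)
proof (induction rule: e_span.induct)
  case zero
  then show ?case using e_span.zero by simp
next
  case (add_term F s z a mu q)
  have part: "is_partition (mu + la)" using add_term assms by (auto simp: is_partition_def)
  have "mu + la = {#n#} \<longleftrightarrow> mu = {#n#} \<and> la = {#} \<or> mu = {#} \<and> la = {#n#}"
    by (auto simp: union_is_single)
  moreover have "(F + series_scale q (elem_sym_part mu)) * elem_sym_part la
      = F * elem_sym_part la + series_scale q (elem_sym_part (mu + la))"
    by (metis distrib_right elem_sym_part_add mult.commute mult_series_scale)
  ultimately show ?case using e_span.add_term[OF add_term.IH part, of q]
    by (cases "la = {#}"; cases "la = {#n#}") simp_all
qed

text \<open>The partition \<open>{#n#}\<close> is a union of two partitions only as itself and the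
  empty one, so its coefficient obeys the product rule. The value \<open>z\<close> is carried for
  this purpose.\<close>

lemma e_span_mult:
  assumes "e_span n F s z a" "e_span n G s' z' a'" "n \<noteq> 0"
  shows "e_span n (F * G) (s * s') (z * z') (z * a' + a * z')"
  using assms(2)
proof (induction rule: e_span.induct)
  case zero
  then show ?case using e_span.zero by simp
next
  case (add_term G s' z' a' la q)
  have F: "F * (G + series_scale q (elem_sym_part la))
      = F * G + series_scale q (F * elem_sym_part la)"
    by (simp add: distrib_left mult_series_scale)
  from e_span_add[OF e_span_scale[OF e_span_mult_part[OF assms(1) add_term.hyps(2) assms(3)], of q] add_term.IH]
  show ?case unfolding F
    by (cases "la = {#}"; cases "la = {#n#}") (simp_all add: algebra_simps)
qed

lemma e_span_elem_sym:
  assumes "k \<noteq> 0"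
  shows "e_span n (elem_sym k) 1 0 (if k = n then 1 else 0)"
  using e_span.add_term[OF e_span.zero, of "{#k#}" n 1] assms
  by (auto simp: is_partition_def elem_sym_part_def)

text \<open>The numbers in \<open>e_span\<close> come with a derivation and not visibly with
  \<open>F\<close>. Here they are tied to an actual expansion, which is unique.\<close>

lemma e_span_expansion:
  assumes "e_span n F s z a"
  obtains c where "e_expansion F c" "s = (\<Sum>la | c la \<noteq> 0. c la)" "a = c {#n#}"
proof -
  have "\<exists>c. e_expansion F c \<and> s = (\<Sum>la | c la \<noteq> 0. c la) \<and> a = c {#n#}"
    using assms
  proof (induction rule: e_span.induct)
    case zero
    then show ?case by (intro exI[of _ "\<lambda>_. 0"]) (auto simp: e_expansion_def)
  next
    case (add_term F s z a la q)
    then obtain c where c: "e_expansion F c" "s = (\<Sum>la | c la \<noteq> 0. c la)" "a = c {#n#}" by blast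
    define d where "d = c(la := c la + q)"
    \<comment> \<open>The term \<open>la\<close> may be new, and adding \<open>q\<close> may cancel
      an old coefficient, so sums are compared over a set containing both supports.\<close>
    let ?S = "insert la {la. c la \<noteq> 0}"
    have fin: "finite ?S" using c by (auto simp: e_expansion_def)
    have sub: "{la. d la \<noteq> 0} \<subseteq> ?S" by (auto simp: d_def)
    have rest: "d mu = c mu" if "mu \<in> ?S - {la}" for mu using that by (simp add: d_def)
    have F: "F = (\<Sum>la\<in>?S. series_scale (c la) (elem_sym_part la))"
      using c fin unfolding e_expansion_def by (auto intro!: sum.mono_neutral_left)
    have s: "s = (\<Sum>la\<in>?S. c la)"
      using c fin by (auto intro!: sum.mono_neutral_left)
    have "(\<Sum>la | d la \<noteq> 0. series_scale (d la) (elem_sym_part la))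
        = (\<Sum>la\<in>?S. series_scale (d la) (elem_sym_part la))"
      using fin sub by (intro sum.mono_neutral_left) auto
    also have "\<dots> = F + series_scale q (elem_sym_part la)"
      unfolding F using fin rest
      by (subst (1 2) sum.remove[of _ la]) (auto simp: d_def series_scale_add add_ac)
    finally have 1: "F + series_scale q (elem_sym_part la)
        = (\<Sum>la | d la \<noteq> 0. series_scale (d la) (elem_sym_part la))" ..
    have "(\<Sum>la | d la \<noteq> 0. d la) = (\<Sum>la\<in>?S. d la)"
      using fin sub by (intro sum.mono_neutral_left) auto
    also have "\<dots> = s + q"
      unfolding s using fin rest by (subst (1 2) sum.remove[of _ la]) (auto simp: d_def)
    finally have 2: "s + q = (\<Sum>la | d la \<noteq> 0. d la)" ..
    have "e_expansion (F + series_scale q (elem_sym_part la)) d"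
      using 1 finite_subset[OF sub fin] sub c(1) add_term.hyps(2) unfolding e_expansion_def by auto
    moreover have "a + (if la = {#n#} then q else 0) = d {#n#}" using c(3) by (auto simp: d_def)
    ultimately show ?case using 2 by blast
  qed
  then show ?thesis using that by blast
qed

section \<open>Power sums\<close>

definition power_sum :: "nat \<Rightarrow> xseries" where
  "power_sum k = Xseries (\<lambda>m. if \<exists>i. m = replicate_mset k i then 1 else 0)"

text \<open>Splits with first part \<open>x_i^k\<close> exist exactly for the \<open>i\<close> of
  multiplicity at least \<open>k\<close> in \<open>m\<close>. As \<open>k\<close> is not 0,
  different \<open>i\<close> give different splits.\<close>

lemma coeff_power_sum_mult:
  assumes "k \<noteq> 0"
  shows "coeff_of (power_sum k * F) m = (\<Sum>i | k \<le> count m i. coeff_of F (m - replicate_mset k i))"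
proof -
  have inj: "inj_on (\<lambda>i. (replicate_mset k i, m - replicate_mset k i)) {i. k \<le> count m i}"
    by (intro inj_onI) (use assms in \<open>auto simp: replicate_mset_eq_iff\<close>)
  have img: "{(a, b) \<in> splits m. \<exists>i. a = replicate_mset k i}
      = (\<lambda>i. (replicate_mset k i, m - replicate_mset k i)) ` {i. k \<le> count m i}"
    by (auto simp: splits_def count_le_replicate_mset_subset_eq image_iff)
  have "coeff_of (power_sum k * F) m = (\<Sum>(a, b)\<in>splits m. coeff_of (power_sum k) a * coeff_of F b)"
    by (simp add: times_xseries.rep_eq)
  also have "\<dots> = (\<Sum>(a, b)\<in>{(a, b) \<in> splits m. \<exists>i. a = replicate_mset k i}. coeff_of F b)"
    by (rule sum.mono_neutral_cong_right) (auto simp: finite_splits power_sum_def Xseries_inverse split: if_splits)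
  also have "\<dots> = (\<Sum>i | k \<le> count m i. coeff_of F (m - replicate_mset k i))"
    unfolding img by (simp add: sum.reindex[OF inj])
  finally show ?thesis .
qed

lemma alternating_telescope:
  fixes N :: "nat \<Rightarrow> rat"
  shows "(\<Sum>i<k. (- 1) ^ i * (N (Suc i) + N (Suc (Suc i)))) = N 1 - (- 1) ^ k * N (Suc k)"
  by (induction k) (auto simp: algebra_simps)

text \<open>Newton's identity: the sum of \<open>(-1)^(j-1) p_j e_(k-j)\<close> over
  \<open>j = 1, ..., k\<close> is \<open>k e_k\<close>, with \<open>j = Suc i\<close>. At a monomial
  of degree \<open>k\<close> the sum telescopes to the size of \<open>N 1\<close>, which is
  \<open>k\<close> for a squarefree monomial and 0 otherwise.\<close>

lemma newton_identity:
  assumes "k \<noteq> 0"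
  shows "(\<Sum>i<k. series_scale ((- 1) ^ i) (power_sum (Suc i) * elem_sym (k - Suc i)))
    = series_scale (of_nat k) (elem_sym k)"
proof (rule xseries_eqI)
  fix m :: "nat multiset"
  \<comment> \<open>A monomial of \<open>p\<^sub>j e\<^bsub>k-j\<^esub>\<close> has a variable of multiplicity \<open>j\<close> or \<open>j + 1\<close>, so the sum telescopes.\<close>
  define N where "N j = {i. count m i = j \<and> (\<forall>l. l \<noteq> i \<longrightarrow> count m l \<le> 1)}" for j
  have coeff: "coeff_of (power_sum (Suc j) * elem_sym (k - Suc j)) m
      = (if size m = k then of_nat (card (N (Suc j))) + of_nat (card (N (Suc (Suc j)))) else 0)"
    if "j < k" for j
  proof -
    have fin: "finite {i. Suc j \<le> count m i}"
      by (rule finite_subset[of _ "set_mset m"]) (auto intro: count_inI)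
    have "coeff_of (power_sum (Suc j) * elem_sym (k - Suc j)) m
      = (\<Sum>i | Suc j \<le> count m i. if size m = k \<and> i \<in> N (Suc j) \<union> N (Suc (Suc j)) then 1 else 0)"
      unfolding coeff_power_sum_mult[OF nat.simps(3)]
    proof (rule sum.cong[OF refl])
      fix i assume "i \<in> {i. Suc j \<le> count m i}"
      then have i: "Suc j \<le> count m i" by simp
      then have sub: "replicate_mset (Suc j) i \<subseteq># m"
        by (simp only: count_le_replicate_mset_subset_eq)
      \<comment> \<open>Both \<open>k\<close> and \<open>size m\<close> are at least
        \<open>Suc j\<close>, so the truncated subtractions can be undone.\<close>
      have "Suc j \<le> size m" using i count_le_size[of m i] by linarith
      moreover have "size (m - replicate_mset (Suc j) i) = size m - Suc j"
        using sub by (simp add: size_Diff_submset)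
      ultimately have sz: "size (m - replicate_mset (Suc j) i) = k - Suc j \<longleftrightarrow> size m = k"
        using that by auto
      have "(\<forall>l. count (m - replicate_mset (Suc j) i) l \<le> 1) \<longleftrightarrow> i \<in> N (Suc j) \<union> N (Suc (Suc j))"
      proof -
        have "(\<forall>l. count (m - replicate_mset (Suc j) i) l \<le> 1)
            \<longleftrightarrow> count m i - Suc j \<le> 1 \<and> (\<forall>l. l \<noteq> i \<longrightarrow> count m l \<le> 1)"
          by (metis count_diff count_replicate_mset diff_zero)
        moreover have "count m i - Suc j \<le> 1 \<longleftrightarrow> count m i = Suc j \<or> count m i = Suc (Suc j)"
          using i by linarith
        ultimately show ?thesis by (auto simp: N_def)
      qed
      with sz show "coeff_of (elem_sym (k - Suc j)) (m - replicate_mset (Suc j) i)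
        = (if size m = k \<and> i \<in> N (Suc j) \<union> N (Suc (Suc j)) then 1 else 0)"
        by (simp add: elem_sym.rep_eq)
    qed
    also have "\<dots> = (if size m = k then of_nat (card (N (Suc j) \<union> N (Suc (Suc j)))) else 0)"
    proof -
      have "{i. Suc j \<le> count m i} \<inter> (N (Suc j) \<union> N (Suc (Suc j))) = N (Suc j) \<union> N (Suc (Suc j))"
        by (auto simp: N_def)
      moreover have "{i. i \<in> N (Suc j) \<or> i \<in> N (Suc (Suc j))} = N (Suc j) \<union> N (Suc (Suc j))"
        by blast
      ultimately show ?thesis using fin by (simp add: sum.If_cases)
    qed
    also have "card (N (Suc j) \<union> N (Suc (Suc j))) = card (N (Suc j)) + card (N (Suc (Suc j)))"
      using fin by (intro card_Un_disjoint) (auto simp: N_def intro!: finite_subset[OF _ fin])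
    finally show ?thesis by simp
  qed
  have "coeff_of (\<Sum>i<k. series_scale ((- 1) ^ i) (power_sum (Suc i) * elem_sym (k - Suc i))) m
     = (if size m = k then \<Sum>i<k. (- 1) ^ i * (of_nat (card (N (Suc i))) + of_nat (card (N (Suc (Suc i))))) else 0)"
    by (simp add: coeff_of_sum series_scale.rep_eq coeff)
  also have "\<dots> = (if size m = k then of_nat (card (N 1)) else 0)"
  proof (cases "size m = k")
    case True
    then have "count m i \<noteq> Suc k" for i using count_le_size[of m i] by linarith
    then have "N (Suc k) = {}" by (simp add: N_def)
    then show ?thesis by (subst alternating_telescope) simp
  qed simp
  also have "\<dots> = coeff_of (series_scale (of_nat k) (elem_sym k)) m"
  proof (cases "size m = k \<and> (\<forall>i. count m i \<le> 1)")
    case True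
    then have "count m i \<le> 1" for i by blast
    then have "0 < count m i \<longleftrightarrow> count m i = 1" for i
      by (metis less_one nat_less_le not_gr_zero)
    with True have "N 1 = set_mset m"
      unfolding N_def set_mset_def by (intro Collect_cong) blast
    moreover have "card (set_mset m) = size m"
      using squarefree_mset_set[of m] True by (metis size_mset_set)
    ultimately show ?thesis using True by (simp add: series_scale.rep_eq elem_sym.rep_eq)
  next
    case False
    then have "size m = k \<Longrightarrow> N 1 = {}" by (auto simp: N_def) (metis order.refl)
    then show ?thesis using False by (auto simp: series_scale.rep_eq elem_sym.rep_eq)
  qed
  finally show "coeff_of (\<Sum>i<k. series_scale ((- 1) ^ i) (power_sum (Suc i) * elem_sym (k - Suc i))) m
     = coeff_of (series_scale (of_nat k) (elem_sym k)) m" .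
qed

text \<open>Newton's identity solved for \<open>p_k\<close>. Up to sign the sum of coefficients is
  \<open>k - (k - 1) = 1\<close>, as each mixed product contributes 1. At \<open>{#n#}\<close> the
  mixed products contribute nothing, both factors having coefficient 0 at the empty
  partition.\<close>

lemma e_span_power_sum:
  assumes "n \<noteq> 0" "k \<noteq> 0"
  shows "e_span n (power_sum k) (- ((- 1) ^ k)) 0 (if k = n then - ((- 1) ^ k) * of_nat n else 0)"
  using assms(2)
proof (induction k rule: less_induct)
  case (less k)
  then obtain j where j: "k = Suc j" by (cases k) auto
  have e0: "elem_sym 0 = 1" by transfer auto
  let ?rest = "\<Sum>i<j. series_scale ((- 1) ^ i) (power_sum (Suc i) * elem_sym (k - Suc i))"
  have "?rest + series_scale ((- 1) ^ j) (power_sum k) = series_scale (of_nat k) (elem_sym k)"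
    using newton_identity[of k] by (simp add: j e0)
  then have "series_scale ((- 1) ^ j) (power_sum k) = series_scale (of_nat k) (elem_sym k) - ?rest"
    by (simp add: algebra_simps)
  \<comment> \<open>The sign \<open>(- 1) ^ j\<close> is its own inverse.\<close>
  from arg_cong[OF this, of "series_scale ((- 1) ^ j)"]
  have p: "power_sum k = series_scale ((- 1) ^ j) (series_scale (of_nat k) (elem_sym k) - ?rest)"
    by (simp add: series_scale_scale flip: power_mult_distrib)
  have rest: "e_span n ?rest (\<Sum>i<j. 1) (\<Sum>i<j. 0) (\<Sum>i<j. 0)"
  proof (rule e_span_sum)
    fix i assume "i \<in> {..<j}"
    then have i: "Suc i < k" by (simp add: j)
    from e_span_mult[OF less.IH[OF i] e_span_elem_sym assms(1), of "k - Suc i"] i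
    have "e_span n (power_sum (Suc i) * elem_sym (k - Suc i)) ((- 1) ^ i) 0 0" by simp
    from e_span_scale[OF this, of "(- 1) ^ i"]
    show "e_span n (series_scale ((- 1) ^ i) (power_sum (Suc i) * elem_sym (k - Suc i))) 1 0 0"
      by (simp flip: power_mult_distrib)
  qed
  show ?case
    using e_span_scale[OF e_span_diff[OF e_span_scale[OF e_span_elem_sym[of k n], of "of_nat k"] rest], of "(- 1) ^ j"] less.prems
    by (subst p) (auto simp: j)
qed

section \<open>Deletion and contraction for weighted graphs\<close>

text \<open>The multiset sum is the product of the \<open>x_(\<kappa> v)^(w v)\<close>. Arbitrary
  relations are allowed, with loops or with only one arc of an edge, so that arcs can be deleted and
  contracted one by one.\<close>

definition wcolorings :: "'a set \<Rightarrow> ('a \<Rightarrow> nat) \<Rightarrow> 'a rel \<Rightarrow> nat multiset \<Rightarrow> ('a \<Rightarrow> nat) set" where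
  "wcolorings V w E m = {\<kappa> \<in> V \<rightarrow>\<^sub>E UNIV.
     (\<forall>(x, y)\<in>E. \<kappa> x \<noteq> \<kappa> y) \<and> (\<Sum>v\<in>V. replicate_mset (w v) (\<kappa> v)) = m}"

lemma wcoloringsI:
  assumes "\<kappa> \<in> V \<rightarrow>\<^sub>E UNIV" "\<And>a b. (a, b) \<in> E \<Longrightarrow> \<kappa> a \<noteq> \<kappa> b"
    "(\<Sum>v\<in>V. replicate_mset (w v) (\<kappa> v)) = m"
  shows "\<kappa> \<in> wcolorings V w E m"
  using assms by (auto simp: wcolorings_def)

lemma wcoloringsD:
  assumes "\<kappa> \<in> wcolorings V w E m"
  shows "\<kappa> \<in> V \<rightarrow>\<^sub>E UNIV" "(a, b) \<in> E \<Longrightarrow> \<kappa> a \<noteq> \<kappa> b"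
    "(\<Sum>v\<in>V. replicate_mset (w v) (\<kappa> v)) = m"
  using assms by (auto simp: wcolorings_def)

definition wchrom :: "'a set \<Rightarrow> ('a \<Rightarrow> nat) \<Rightarrow> 'a rel \<Rightarrow> xseries" where
  "wchrom V w E = Xseries (\<lambda>m. of_nat (card (wcolorings V w E m)))"

lemma coeff_wchrom: "coeff_of (wchrom V w E) m = of_nat (card (wcolorings V w E m))"
  by (simp add: wchrom_def Xseries_inverse)

text \<open>Positive weights make every colour used occur in \<open>m\<close>. Finiteness matters
  because \<open>card\<close> is 0 on infinite sets.\<close>

lemma finite_wcolorings:
  assumes "finite V" "\<And>v. v \<in> V \<Longrightarrow> w v \<noteq> 0"
  shows "finite (wcolorings V w E m)"
proof (rule finite_subset)
  show "wcolorings V w E m \<subseteq> V \<rightarrow>\<^sub>E set_mset m"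
  proof
    fix \<kappa> assume "\<kappa> \<in> wcolorings V w E m"
    then have \<kappa>: "\<kappa> \<in> V \<rightarrow>\<^sub>E UNIV" and m: "m = (\<Sum>v\<in>V. replicate_mset (w v) (\<kappa> v))"
      by (auto simp: wcolorings_def)
    have "\<kappa> v \<in># m" if "v \<in> V" for v
      using that assms(2)[OF that] unfolding m sum.remove[OF assms(1) that] by simp
    with \<kappa> show "\<kappa> \<in> V \<rightarrow>\<^sub>E set_mset m" by (auto simp: PiE_iff)
  qed
  show "finite (V \<rightarrow>\<^sub>E set_mset m)" using assms by (simp add: finite_PiE)
qed

lemma wchrom_loop: "(x, x) \<in> E \<Longrightarrow> wchrom V w E = 0"
proof (rule xseries_eqI)
  fix m assume "(x, x) \<in> E"
  then have "wcolorings V w E m = {}" by (auto simp: wcolorings_def)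
  then show "coeff_of (wchrom V w E) m = coeff_of 0 m"
    by (simp add: coeff_wchrom zero_xseries.rep_eq)
qed

lemma wchrom_flip: "wchrom V w (insert (y, x) E) = wchrom V w (insert (x, y) E)"
  unfolding wchrom_def wcolorings_def by (rule arg_cong[of _ _ Xseries], rule ext) (auto intro!: arg_cong[of _ _ card])

lemma wchrom_both: "(y, x) \<in> E \<Longrightarrow> wchrom V w (insert (x, y) E) = wchrom V w E"
  by (metis insert_absorb wchrom_flip)

text \<open>The vertex \<open>y\<close> is renamed to \<open>x\<close>. A remaining arc between the
  two becomes a loop, and parallel arcs merge.\<close>

definition contract :: "'a \<Rightarrow> 'a \<Rightarrow> 'a rel \<Rightarrow> 'a rel" where
  "contract x y E = map_prod (id(y := x)) (id(y := x)) ` E"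

text \<open>Colourings proper for \<open>E\<close> either separate \<open>x\<close> and
  \<open>y\<close> or give them one colour. The latter are the colourings of the contraction; its
  merged vertex carries both weights, so monomials are preserved.\<close>

lemma wchrom_deletion_contraction:
  assumes V: "finite V" "x \<in> V" "y \<in> V" "x \<noteq> y" and E: "E \<subseteq> V \<times> V"
    and w: "\<And>v. v \<in> V \<Longrightarrow> w v \<noteq> 0"
  shows "wchrom V w (insert (x, y) E)
    = wchrom V w E - wchrom (V - {y}) (w(x := w x + w y)) (contract x y E)"
proof (rule xseries_eqI)
  fix m :: "nat multiset"
  let ?w = "w(x := w x + w y)"
  let ?K = "{\<kappa> \<in> wcolorings V w E m. \<kappa> x = \<kappa> y}"
  have weight: "(\<Sum>v\<in>V. replicate_mset (w v) (\<kappa> v)) = (\<Sum>v\<in>V - {y}. replicate_mset (?w v) (\<kappa> v))"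
    if "\<kappa> x = \<kappa> y" for \<kappa> :: "'a \<Rightarrow> nat"
  proof -
    have "(\<Sum>v\<in>V. replicate_mset (w v) (\<kappa> v)) = replicate_mset (w y) (\<kappa> y) +
        (replicate_mset (w x) (\<kappa> x) + (\<Sum>v\<in>V - {y} - {x}. replicate_mset (w v) (\<kappa> v)))"
      using V by (simp add: sum.remove[of V y] sum.remove[of "V - {y}" x])
    also have "\<dots> = replicate_mset (?w x) (\<kappa> x) + (\<Sum>v\<in>V - {y} - {x}. replicate_mset (?w v) (\<kappa> v))"
      using that by (simp add: multiset_eq_iff)
    also have "\<dots> = (\<Sum>v\<in>V - {y}. replicate_mset (?w v) (\<kappa> v))"
      using V by (subst (2) sum.remove[of _ x]) auto
    finally show ?thesis .
  qed
  \<comment> \<open>The inverse of the restriction gives \<open>y\<close> the colour of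
    \<open>x\<close>.\<close>
  have "bij_betw (\<lambda>\<kappa>. restrict \<kappa> (V - {y})) ?K (wcolorings (V - {y}) ?w (contract x y E) m)"
  proof (rule bij_betw_byWitness[where f' = "\<lambda>\<kappa>. \<kappa>(y := \<kappa> x)"])
    show "\<forall>\<kappa>\<in>?K. (restrict \<kappa> (V - {y}))(y := restrict \<kappa> (V - {y}) x) = \<kappa>"
      using V by (auto simp: wcolorings_def PiE_def extensional_def fun_eq_iff)
    show "\<forall>\<kappa>\<in>wcolorings (V - {y}) ?w (contract x y E) m. restrict (\<kappa>(y := \<kappa> x)) (V - {y}) = \<kappa>"
      by (auto simp: wcolorings_def PiE_def extensional_def fun_eq_iff)
    show "(\<lambda>\<kappa>. restrict \<kappa> (V - {y})) ` ?K \<subseteq> wcolorings (V - {y}) ?w (contract x y E) m"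
    proof clarify
      fix \<kappa> assume \<kappa>: "\<kappa> \<in> wcolorings V w E m" "\<kappa> x = \<kappa> y"
      have r: "restrict \<kappa> (V - {y}) ((id(y := x)) a) = \<kappa> a" if "a \<in> V" for a
        using that V \<kappa>(2) by auto
      have "restrict \<kappa> (V - {y}) a \<noteq> restrict \<kappa> (V - {y}) b" if ab: "(a, b) \<in> contract x y E" for a b
      proof -
        obtain a' b' where e: "(a', b') \<in> E" and ab': "a = (id(y := x)) a'" "b = (id(y := x)) b'"
          using ab unfolding contract_def by force
        have "a' \<in> V" "b' \<in> V" "\<kappa> a' \<noteq> \<kappa> b'"
          using e E \<kappa>(1) by (auto simp: wcolorings_def)
        then show ?thesis using r by (simp only: ab' not_False_eq_True)
      qed
      moreover have "(\<Sum>v\<in>V - {y}. replicate_mset (?w v) (restrict \<kappa> (V - {y}) v)) = m"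
        unfolding wcoloringsD(3)[OF \<kappa>(1), symmetric] weight[OF \<kappa>(2)] by (intro sum.cong) auto
      moreover have "restrict \<kappa> (V - {y}) \<in> (V - {y}) \<rightarrow>\<^sub>E UNIV" by auto
      ultimately show "restrict \<kappa> (V - {y}) \<in> wcolorings (V - {y}) ?w (contract x y E) m"
        by (intro wcoloringsI)
    qed
    show "(\<lambda>\<kappa>. \<kappa>(y := \<kappa> x)) ` wcolorings (V - {y}) ?w (contract x y E) m \<subseteq> ?K"
    proof (rule image_subsetI)
      fix \<kappa> assume \<kappa>: "\<kappa> \<in> wcolorings (V - {y}) ?w (contract x y E) m"
      let ?k = "\<kappa>(y := \<kappa> x)"
      have k: "?k a = \<kappa> ((id(y := x)) a)" for a by simp
      have "?k a \<noteq> ?k b" if "(a, b) \<in> E" for a b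
      proof -
        have "((id(y := x)) a, (id(y := x)) b) \<in> contract x y E"
          using that unfolding contract_def by force
        then show ?thesis unfolding k by (rule wcoloringsD(2)[OF \<kappa>])
      qed
      moreover have "?k \<in> V \<rightarrow>\<^sub>E UNIV"
        using \<kappa> V by (auto simp: wcolorings_def PiE_def extensional_def)
      moreover have "?k x = ?k y" using V by simp
      moreover have "(\<Sum>v\<in>V. replicate_mset (w v) (?k v)) = m"
        unfolding weight[OF \<open>?k x = ?k y\<close>] wcoloringsD(3)[OF \<kappa>, symmetric]
        by (intro sum.cong) auto
      ultimately show "?k \<in> ?K" using wcoloringsI[of ?k V E w m] by blast
    qed
  qed
  then have K: "card ?K = card (wcolorings (V - {y}) ?w (contract x y E) m)"
    by (rule bij_betw_same_card)
  have "wcolorings V w E m = wcolorings V w (insert (x, y) E) m \<union> ?K"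
    "wcolorings V w (insert (x, y) E) m \<inter> ?K = {}"
    by (auto simp: wcolorings_def)
  then have "card (wcolorings V w E m) = card (wcolorings V w (insert (x, y) E) m) + card ?K"
    using finite_wcolorings[of V w] V w by (metis (no_types, lifting) card_Un_disjoint finite_Un)
  then show "coeff_of (wchrom V w (insert (x, y) E)) m
    = coeff_of (wchrom V w E - wchrom (V - {y}) ?w (contract x y E)) m"
    by (simp add: coeff_wchrom minus_xseries.rep_eq K)
qed

text \<open>The colour \<open>i\<close> of \<open>v\<close> is unconstrained and accounts for
  \<open>x_i^(w v)\<close>; the rest of the monomial comes from a colouring of \<open>U\<close>.
  Grouping by \<open>i\<close> gives the coefficient formula for a product with a power sum.\<close>

lemma wchrom_isolated:
  assumes U: "finite U" "v \<notin> U" "E \<subseteq> U \<times> U" and w: "\<And>x. x \<in> insert v U \<Longrightarrow> w x \<noteq> 0"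
  shows "wchrom (insert v U) w E = power_sum (w v) * wchrom U w E"
proof (rule xseries_eqI)
  fix m :: "nat multiset"
  let ?I = "{i. w v \<le> count m i}"
  let ?C = "\<lambda>i. wcolorings U w E (m - replicate_mset (w v) i)"
  have wv: "w v \<noteq> 0" using w by simp
  have fin: "finite ?I"
    by (rule finite_subset[of _ "set_mset m"]) (use wv in \<open>auto intro: count_inI\<close>)
  have sum_upd: "(\<Sum>x\<in>U. replicate_mset (w x) ((\<kappa>(v := i)) x)) = (\<Sum>x\<in>U. replicate_mset (w x) (\<kappa> x))"
    for \<kappa> :: "'a \<Rightarrow> nat" and i using U by (auto intro!: sum.cong)
  have upd: "\<kappa>(v := i) \<in> wcolorings (insert v U) w E m" if "i \<in> ?I" "\<kappa> \<in> ?C i" for \<kappa> i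
  proof -
    have "\<kappa>(v := i) \<in> insert v U \<rightarrow>\<^sub>E UNIV"
      using that by (auto simp: wcolorings_def PiE_def extensional_def)
    moreover have "(\<kappa>(v := i)) a \<noteq> (\<kappa>(v := i)) b" if "(a, b) \<in> E" for a b
    proof -
      have "a \<noteq> v" "b \<noteq> v" using that U by auto
      then show ?thesis using wcoloringsD(2)[OF \<open>\<kappa> \<in> ?C i\<close> that] by simp
    qed
    moreover have "replicate_mset (w v) i \<subseteq># m"
      using that by (simp add: count_le_replicate_mset_subset_eq)
    then have "(\<Sum>x\<in>insert v U. replicate_mset (w x) ((\<kappa>(v := i)) x)) = m"
      unfolding sum.insert[OF U(1,2)] sum_upd wcoloringsD(3)[OF \<open>\<kappa> \<in> ?C i\<close>] by simp
    ultimately show ?thesis by (rule wcoloringsI)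
  qed
  have "wcolorings (insert v U) w E m = (\<Union>i\<in>?I. (\<lambda>\<kappa>. \<kappa>(v := i)) ` ?C i)"
  proof (intro equalityI subsetI)
    fix \<kappa> assume \<kappa>: "\<kappa> \<in> wcolorings (insert v U) w E m"
    have m: "m = replicate_mset (w v) (\<kappa> v) + (\<Sum>x\<in>U. replicate_mset (w x) (\<kappa> x))"
      using wcoloringsD(3)[OF \<kappa>] U by simp
    have "\<kappa> v \<in> ?I" by (subst m) simp
    \<comment> \<open>Colourings of \<open>U\<close> are extensional, so the value at
      \<open>v\<close> has to be reset to \<open>undefined\<close>.\<close>
    moreover have "(\<kappa>(v := undefined)) \<in> ?C (\<kappa> v)"
    proof -
      have "\<kappa>(v := undefined) \<in> U \<rightarrow>\<^sub>E UNIV"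
        using \<kappa> by (auto simp: wcolorings_def PiE_def extensional_def)
      moreover have "(\<kappa>(v := undefined)) a \<noteq> (\<kappa>(v := undefined)) b" if "(a, b) \<in> E" for a b
      proof -
        have "a \<noteq> v" "b \<noteq> v" using that U by auto
        then show ?thesis using wcoloringsD(2)[OF \<kappa> that] by simp
      qed
      moreover have "(\<Sum>x\<in>U. replicate_mset (w x) ((\<kappa>(v := undefined)) x)) = m - replicate_mset (w v) (\<kappa> v)"
        unfolding sum_upd by (subst m) simp
      ultimately show ?thesis by (rule wcoloringsI)
    qed
    ultimately show "\<kappa> \<in> (\<Union>i\<in>?I. (\<lambda>\<kappa>. \<kappa>(v := i)) ` ?C i)"
      by (intro UN_I[of "\<kappa> v"] image_eqI[of _ _ "\<kappa>(v := undefined)"]) auto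
  qed (use upd in blast)
  also have "card \<dots> = (\<Sum>i\<in>?I. card ((\<lambda>\<kappa>. \<kappa>(v := i)) ` ?C i))"
  proof (rule card_UN_disjoint[OF fin])
    show "\<forall>i\<in>?I. finite ((\<lambda>\<kappa>. \<kappa>(v := i)) ` ?C i)"
      using U w by (auto intro!: finite_imageI finite_wcolorings)
    show "\<forall>i\<in>?I. \<forall>j\<in>?I. i \<noteq> j \<longrightarrow> (\<lambda>\<kappa>. \<kappa>(v := i)) ` ?C i \<inter> (\<lambda>\<kappa>. \<kappa>(v := j)) ` ?C j = {}"
      by (auto dest: fun_cong[of _ _ v])
  qed
  also have "\<dots> = (\<Sum>i\<in>?I. card (?C i))"
  proof (intro sum.cong refl card_image inj_onI)
    fix i \<kappa> \<kappa>' assume "\<kappa> \<in> ?C i" "\<kappa>' \<in> ?C i" "\<kappa>(v := i) = \<kappa>'(v := i)"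
    then show "\<kappa> = \<kappa>'"
      using U by (auto simp: wcolorings_def PiE_def extensional_def fun_eq_iff split: if_splits)
        (metis)
  qed
  finally show "coeff_of (wchrom (insert v U) w E) m = coeff_of (power_sum (w v) * wchrom U w E) m"
    by (simp add: coeff_wchrom coeff_power_sum_mult[OF wv])
qed

lemma wchrom_empty: "wchrom {} w {} = 1"
proof (rule xseries_eqI)
  fix m :: "nat multiset"
  have "wcolorings {} w {} m = (if m = {#} then {\<lambda>_. undefined} else {})"
    by (auto simp: wcolorings_def)
  then show "coeff_of (wchrom {} w {}) m = coeff_of 1 m"
    by (simp add: coeff_wchrom one_xseries.rep_eq)
qed

lemma wchrom_single: "w v \<noteq> 0 \<Longrightarrow> wchrom {v} w {} = power_sum (w v)"
  using wchrom_isolated[of "{}" v "{}" w] by (simp add: wchrom_empty)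

section \<open>Connected relations\<close>

definition linked :: "'a rel \<Rightarrow> 'a rel" where
  "linked E = (E \<union> E\<inverse>)\<^sup>*"

text \<open>Linking paths need not stay inside \<open>V\<close>. Where connectedness of a subset
  \<open>U\<close> in itself is meant, the relation is first cut down to
  \<open>U \<times> U\<close>.\<close>

definition connected_on :: "'a set \<Rightarrow> 'a rel \<Rightarrow> bool" where
  "connected_on V E \<longleftrightarrow> V \<times> V \<subseteq> linked E"

text \<open>A loop is linked by the empty path, so this also excludes loops.\<close>

definition forest_rel :: "'a rel \<Rightarrow> bool" where
  "forest_rel E \<longleftrightarrow> (\<forall>(x, y)\<in>E. (x, y) \<notin> linked (E - {(x, y), (y, x)}))"

lemma linked_mono: "E \<subseteq> F \<Longrightarrow> linked E \<subseteq> linked F"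
  unfolding linked_def by (intro rtrancl_mono) auto

lemma linked_sym: "(x, y) \<in> linked E \<Longrightarrow> (y, x) \<in> linked E"
  unfolding linked_def by (rule symD[OF sym_rtrancl[OF sym_Un_converse]])

lemma linked_trans: "(x, y) \<in> linked E \<Longrightarrow> (y, z) \<in> linked E \<Longrightarrow> (x, z) \<in> linked E"
  unfolding linked_def by (rule rtrancl_trans)

lemma linked_edge: "(x, y) \<in> E \<Longrightarrow> (x, y) \<in> linked E"
  unfolding linked_def by auto

lemma linked_refl: "(x, x) \<in> linked E"
  unfolding linked_def by auto

lemma forest_rel_mono: "forest_rel F \<Longrightarrow> E \<subseteq> F \<Longrightarrow> forest_rel E"
proof (unfold forest_rel_def, intro ballI, clarify)
  fix x y assume F: "\<forall>(x, y)\<in>F. (x, y) \<notin> linked (F - {(x, y), (y, x)})"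
    and "E \<subseteq> F" "(x, y) \<in> E" "(x, y) \<in> linked (E - {(x, y), (y, x)})"
  moreover from this have "linked (E - {(x, y), (y, x)}) \<subseteq> linked (F - {(x, y), (y, x)})"
    by (intro linked_mono) auto
  ultimately show False by blast
qed

lemma connected_on_mono: "connected_on V E \<Longrightarrow> E \<subseteq> F \<Longrightarrow> connected_on V F"
  unfolding connected_on_def by (erule order_trans) (rule linked_mono)

lemma connected_on_insert:
  assumes "connected_on U E" "u \<in> U" "(u, v) \<in> E \<or> (v, u) \<in> E"
  shows "connected_on (insert v U) E"
proof -
  have "(x, u) \<in> linked E" if "x \<in> insert v U" for x
    using that assms by (auto simp: connected_on_def linked_edge intro: linked_sym[OF linked_edge])
  then have "(x, y) \<in> linked E" if "x \<in> insert v U" "y \<in> insert v U" for x y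
    using that by (meson linked_sym linked_trans)
  then show ?thesis unfolding connected_on_def by auto
qed

lemma linked_map:
  assumes "(a, b) \<in> linked E"
  shows "(f a, f b) \<in> linked (map_prod f f ` E)"
  using assms unfolding linked_def
proof (induction rule: rtrancl_induct)
  case (step b c)
  then have "(f b, f c) \<in> map_prod f f ` E \<union> (map_prod f f ` E)\<inverse>" by force
  with step.IH show ?case by (rule rtrancl_into_rtrancl)
qed simp

lemma connected_on_contract:
  assumes "connected_on V E" "x \<in> V" "y \<in> V" "x \<noteq> y"
  shows "connected_on (V - {y}) (contract x y E)"
  unfolding connected_on_def
proof (rule subrelI)
  fix a b assume "(a, b) \<in> (V - {y}) \<times> (V - {y})"
  then have ab: "a \<in> V" "a \<noteq> y" "b \<in> V" "b \<noteq> y" by auto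
  then have "(a, b) \<in> linked E" using assms by (auto simp: connected_on_def)
  from linked_map[OF this, of "id(y := x)"] ab show "(a, b) \<in> linked (contract x y E)"
    by (simp add: contract_def)
qed

lemma linked_crossing:
  assumes "(a, b) \<in> linked E" "a \<in> U" "b \<notin> U"
  shows "\<exists>x y. x \<in> U \<and> y \<notin> U \<and> ((x, y) \<in> E \<or> (y, x) \<in> E)"
  using assms unfolding linked_def
  by (induction rule: rtrancl_induct) auto

text \<open>The set \<open>U\<close> is a maximal proper subset of \<open>V\<close> that is connected in itself.\<close>

lemma connected_on_leaf:
  assumes "finite V" "card V \<ge> 2" "E \<subseteq> V \<times> V" "connected_on V E"
  obtains U u v where "V = insert v U" "v \<notin> U" "u \<in> U" "(u, v) \<in> E \<or> (v, u) \<in> E"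
    "connected_on U (E \<inter> U \<times> U)"
proof -
  let ?P = "\<lambda>U. U \<subset> V \<and> U \<noteq> {} \<and> connected_on U (E \<inter> U \<times> U)"
  obtain a where a: "a \<in> V" using assms(2) by fastforce
  have "{a} \<noteq> V" using assms(2) by auto
  then have "?P {a}" using a by (auto simp: connected_on_def linked_refl)
  moreover have "\<forall>U. ?P U \<longrightarrow> card U < Suc (card V)"
    using assms(1) by (auto intro: less_SucI psubset_card_mono)
  ultimately have "\<exists>U. ?P U \<and> (\<forall>U'. ?P U' \<longrightarrow> card U' \<le> card U)"
    by (rule ex_has_greatest_nat)
  then obtain U where U: "?P U" and max: "\<And>U'. ?P U' \<Longrightarrow> card U' \<le> card U"
    by metis
  then obtain b c where "b \<in> U" "c \<in> V" "c \<notin> U" by blast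
  moreover from this have "(b, c) \<in> linked E"
    using U assms(4) by (auto simp: connected_on_def)
  ultimately obtain u v where uv: "u \<in> U" "v \<notin> U" "(u, v) \<in> E \<or> (v, u) \<in> E"
    using linked_crossing by metis
  then have "v \<in> V" using assms(3) by blast
  let ?U = "insert v U"
  have "connected_on U (E \<inter> ?U \<times> ?U)"
    by (rule connected_on_mono[of U "E \<inter> U \<times> U"]) (use U in auto)
  then have conn: "connected_on ?U (E \<inter> ?U \<times> ?U)"
    by (rule connected_on_insert[of _ _ u]) (use uv in auto)
  have "finite U" using U assms(1) by (meson finite_subset psubset_imp_subset)
  then have "card ?U > card U" using uv by simp
  \<comment> \<open>Being connected and larger than \<open>U\<close>, the set \<open>?U\<close>
    cannot be a proper subset of \<open>V\<close>.\<close>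
  then have "V = ?U" using max[of ?U] U conn \<open>v \<in> V\<close> by force
  then show ?thesis using that uv U by blast
qed

section \<open>The two functionals on chromatic symmetric functions of connected graphs\<close>

text \<open>
  Up to sign, \<open>\<beta>\<close> is the sum of all coefficients and \<open>n * \<alpha>\<close> the coefficient at \<open>(n)\<close>, where \<open>n\<close>
  is the total weight. That neither depends on the weights is essential for removing a leaf.
\<close>

definition chrom_data :: "'a set \<Rightarrow> 'a rel \<Rightarrow> rat \<Rightarrow> rat \<Rightarrow> bool" where
  "chrom_data V E \<alpha> \<beta> \<longleftrightarrow>
     0 \<le> \<alpha> \<and> \<beta> \<le> 2 ^ (card V - 1) * \<alpha> \<and> (irrefl E \<longrightarrow> 1 \<le> \<alpha>) \<and>
     (forest_rel E \<longrightarrow> \<beta> = 2 ^ (card V - 1) * \<alpha>) \<and>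
     (\<forall>w n. n \<noteq> 0 \<longrightarrow> (\<forall>v\<in>V. w v \<noteq> 0) \<longrightarrow>
        e_span n (wchrom V w E) ((- 1) ^ (sum w V + card V) * \<beta>) 0
          (if sum w V = n then (- 1) ^ (n + card V) * (of_nat n * \<alpha>) else 0))"

lemma chrom_data_span:
  assumes "chrom_data V E \<alpha> \<beta>" "n \<noteq> 0" "\<And>v. v \<in> V \<Longrightarrow> w v \<noteq> 0"
  shows "e_span n (wchrom V w E) ((- 1) ^ (sum w V + card V) * \<beta>) 0
     (if sum w V = n then (- 1) ^ (n + card V) * (of_nat n * \<alpha>) else 0)"
  using assms unfolding chrom_data_def by blast

lemma forest_rel_irrefl: "forest_rel E \<Longrightarrow> irrefl E"
  by (auto simp: forest_rel_def irrefl_def linked_refl)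

text \<open>With a loop there is no proper colouring, so both numbers are 0; the clauses for
  loopless relations and for forests hold vacuously.\<close>

lemma chrom_data_loop:
  assumes "(x, x) \<in> E"
  shows "chrom_data V E 0 0"
proof -
  have "\<not> irrefl E" using assms by (auto simp: irrefl_def)
  then show ?thesis using forest_rel_irrefl[of E] e_span.zero
    by (auto simp: chrom_data_def wchrom_loop[OF assms])
qed

lemma chrom_data_single: "chrom_data {v} {} 1 1"
  unfolding chrom_data_def
proof (intro conjI allI impI)
  fix w n assume "n \<noteq> (0::nat)" "\<forall>x\<in>{v}. w x \<noteq> (0::nat)"
  then show "e_span n (wchrom {v} w {}) ((- 1) ^ (sum w {v} + card {v}) * 1) 0
      (if sum w {v} = n then (- 1) ^ (n + card {v}) * (of_nat n * 1) else 0)"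
    using e_span_power_sum[of n "w v"] by (auto simp: wchrom_single)
qed auto

text \<open>The edge is already present as \<open>(y, x)\<close>: colourings do not change, and
  \<open>forest_rel\<close> passes to the smaller relation.\<close>

lemma chrom_data_both:
  assumes "chrom_data V E \<alpha> \<beta>" "(y, x) \<in> E"
  shows "chrom_data V (insert (x, y) E) \<alpha> \<beta>"
  using assms forest_rel_mono[of "insert (x, y) E" E]
  by (auto simp: chrom_data_def wchrom_both irrefl_def)

lemma sum_merge:
  fixes w :: "'a \<Rightarrow> nat"
  assumes "finite V" "x \<in> V" "y \<in> V" "x \<noteq> y"
  shows "sum (w(x := w x + w y)) (V - {y}) = sum w V"
  using assms by (simp add: sum.remove[of V y] sum.remove[of "V - {y}" x])

text \<open>Deletion-contraction makes both numbers additive: the contraction has one vertex less,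
  and this parity turns the minus sign into a plus. The new edge closes a cycle, so the forest
  clause is vacuous.\<close>

lemma chrom_data_nonbridge:
  assumes V: "finite V" "x \<in> V" "y \<in> V" "x \<noteq> y" and E: "E \<subseteq> V \<times> V"
    and link: "(x, y) \<in> linked (E - {(y, x)})" and notin: "(x, y) \<notin> E"
    and del: "chrom_data V E \<alpha> \<beta>"
    and con: "chrom_data (V - {y}) (contract x y E) \<alpha>' \<beta>'"
  shows "chrom_data V (insert (x, y) E) (\<alpha> + \<alpha>') (\<beta> + \<beta>')"
  unfolding chrom_data_def
proof (intro conjI impI allI)
  have "x \<in> V - {y}" using V by simp
  then have card: "card V = Suc (card (V - {y}))" "card (V - {y}) \<noteq> 0"
    using V card.remove[OF V(1,3)] card_eq_0_iff[of "V - {y}"] by blast+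
  show "0 \<le> \<alpha> + \<alpha>'" using del con by (simp add: chrom_data_def)
  have "\<beta>' \<le> 2 ^ (card (V - {y}) - 1) * \<alpha>'" "0 \<le> \<alpha>'"
    using con by (auto simp: chrom_data_def)
  \<comment> \<open>The contraction satisfies the bound with half the factor; doubling it is allowed
    because \<open>\<alpha>'\<close> is nonnegative.\<close>
  moreover have "2 ^ (card (V - {y}) - 1) * \<alpha>' \<le> 2 ^ (card V - 1) * \<alpha>'"
    using \<open>0 \<le> \<alpha>'\<close> card by (intro mult_right_mono power_increasing) auto
  moreover have "\<beta> \<le> 2 ^ (card V - 1) * \<alpha>"
    using del by (simp add: chrom_data_def)
  ultimately show "\<beta> + \<beta>' \<le> 2 ^ (card V - 1) * (\<alpha> + \<alpha>')"
    unfolding distrib_left by linarith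
  show "1 \<le> \<alpha> + \<alpha>'" if "irrefl (insert (x, y) E)"
    using that del con by (auto simp: chrom_data_def irrefl_def)
  show "\<beta> + \<beta>' = 2 ^ (card V - 1) * (\<alpha> + \<alpha>')" if "forest_rel (insert (x, y) E)"
  proof -
    have "insert (x, y) E - {(x, y), (y, x)} = E - {(y, x)}" using notin by auto
    then show ?thesis using that link by (simp add: forest_rel_def)
  qed
  fix w n assume n: "n \<noteq> (0::nat)" and w: "\<forall>v\<in>V. w v \<noteq> (0::nat)"
  let ?w = "w(x := w x + w y)"
  note span1 = chrom_data_span[OF del n, of w]
  note span2 = chrom_data_span[OF con n, of ?w]
  have dc: "wchrom V w (insert (x, y) E) = wchrom V w E - wchrom (V - {y}) ?w (contract x y E)"
    using V E w by (intro wchrom_deletion_contraction) auto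
  have "e_span n (wchrom V w (insert (x, y) E))
    ((- 1) ^ (sum w V + card V) * \<beta> - (- 1) ^ (sum w V + card (V - {y})) * \<beta>') (0 - 0)
    ((if sum w V = n then (- 1) ^ (n + card V) * (of_nat n * \<alpha>) else 0)
      - (if sum w V = n then (- 1) ^ (n + card (V - {y})) * (of_nat n * \<alpha>') else 0))"
    unfolding dc using span1 span2 w V unfolding sum_merge[OF V]
    by (intro e_span_diff) auto
  then show "e_span n (wchrom V w (insert (x, y) E)) ((- 1) ^ (sum w V + card V) * (\<beta> + \<beta>')) 0
    (if sum w V = n then (- 1) ^ (n + card V) * (of_nat n * (\<alpha> + \<alpha>')) else 0)"
    by (auto simp: card(1) algebra_simps)
qed

text \<open>Deleting the arc isolates \<open>v\<close>, and contracting it moves the weight of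
  \<open>v\<close> to \<open>u\<close>. The product with the power sum has no coefficient at
  \<open>{#n#}\<close>, so \<open>\<alpha>\<close> comes from the contraction alone. In the sum of
  coefficients both terms contribute \<open>\<beta>\<close> with the same sign.\<close>

lemma chrom_data_leaf:
  assumes U: "finite U" "u \<in> U" "v \<notin> U" and E: "E \<subseteq> U \<times> U"
    and data: "chrom_data U E \<alpha> \<beta>"
  shows "chrom_data (insert v U) (insert (u, v) E) \<alpha> (2 * \<beta>)"
  unfolding chrom_data_def
proof (intro conjI impI allI)
  have card: "card (insert v U) = Suc (card U)" "2 ^ (card (insert v U) - 1) = (2 * 2 ^ (card U - 1) :: rat)"
  proof -
    obtain k where "card U = Suc k" using U by (metis card_0_eq empty_iff not0_implies_Suc)
    then show "card (insert v U) = Suc (card U)" "2 ^ (card (insert v U) - 1) = (2 * 2 ^ (card U - 1) :: rat)"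
      using U by auto
  qed
  show "0 \<le> \<alpha>" "2 * \<beta> \<le> 2 ^ (card (insert v U) - 1) * \<alpha>"
    using data unfolding card(2) by (auto simp: chrom_data_def)
  show "1 \<le> \<alpha>" if "irrefl (insert (u, v) E)"
    using that data by (auto simp: chrom_data_def irrefl_def)
  show "2 * \<beta> = 2 ^ (card (insert v U) - 1) * \<alpha>" if "forest_rel (insert (u, v) E)"
    using forest_rel_mono[OF that, of E] data unfolding card(2) by (auto simp: chrom_data_def)
  fix w n assume n: "n \<noteq> (0::nat)" and w: "\<forall>x\<in>insert v U. w x \<noteq> (0::nat)"
  let ?w = "w(u := w u + w v)"
  have "u \<noteq> v" using U by auto
  have sums: "sum w (insert v U) = w v + sum w U" "sum ?w U = w v + sum w U"
    using U sum_merge[of "insert v U" u v w] by auto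
  \<comment> \<open>No arc of \<open>E\<close> touches \<open>v\<close>, so the renaming acts as the
    identity on it.\<close>
  have "contract u v E = id ` E"
    unfolding contract_def using E U by (intro image_cong) auto
  then have "contract u v E = E" by simp
  moreover have "insert v U - {v} = U" using U by auto
  ultimately have dc: "wchrom (insert v U) w (insert (u, v) E) = power_sum (w v) * wchrom U w E - wchrom U ?w E"
    using wchrom_deletion_contraction[of "insert v U" u v E w] wchrom_isolated[of U v E w] U E w \<open>u \<noteq> v\<close>
    by (auto simp: subset_iff)
  have "e_span n (power_sum (w v)) (- ((- 1) ^ w v)) 0 (if w v = n then - ((- 1) ^ w v) * of_nat n else 0)"
    using n w by (intro e_span_power_sum) auto
  moreover have "e_span n (wchrom U w E) ((- 1) ^ (sum w U + card U) * \<beta>) 0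
     (if sum w U = n then (- 1) ^ (n + card U) * (of_nat n * \<alpha>) else 0)"
    using w by (intro chrom_data_span[OF data n]) auto
  ultimately have span1: "e_span n (power_sum (w v) * wchrom U w E)
      (- ((- 1) ^ w v) * ((- 1) ^ (sum w U + card U) * \<beta>)) 0 0"
    using e_span_mult[OF _ _ n] by fastforce
  have span2: "e_span n (wchrom U ?w E) ((- 1) ^ (w v + sum w U + card U) * \<beta>) 0
     (if w v + sum w U = n then (- 1) ^ (n + card U) * (of_nat n * \<alpha>) else 0)"
    using chrom_data_span[OF data n, of ?w] w unfolding sums by auto
  show "e_span n (wchrom (insert v U) w (insert (u, v) E))
      ((- 1) ^ (sum w (insert v U) + card (insert v U)) * (2 * \<beta>)) 0
      (if sum w (insert v U) = n then (- 1) ^ (n + card (insert v U)) * (of_nat n * \<alpha>) else 0)"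
    unfolding dc sums card(1) using e_span_diff[OF span1 span2]
    by (auto simp: power_add algebra_simps)
qed

text \<open>A leaf edge may be given by either of its arcs, so the leaf step has to be available for
  both.\<close>

lemma chrom_data_flip: "chrom_data V (insert (x, y) E) \<alpha> \<beta> \<Longrightarrow> chrom_data V (insert (y, x) E) \<alpha> \<beta>"
proof -
  have linked: "linked (insert (a, b) F) = linked (insert (b, a) F)" for a b :: 'a and F
  proof -
    have "insert (a, b) F \<union> (insert (a, b) F)\<inverse> = insert (b, a) F \<union> (insert (b, a) F)\<inverse>" by auto
    then show ?thesis by (simp add: linked_def)
  qed
  have del: "linked (insert (x, y) E - {(a, b), (b, a)}) = linked (insert (y, x) E - {(a, b), (b, a)})" for a b
  proof (cases "(x, y) \<in> {(a, b), (b, a)}")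
    case True
    then have "insert (x, y) E - {(a, b), (b, a)} = insert (y, x) E - {(a, b), (b, a)}" by auto
    then show ?thesis by simp
  next
    case False
    then have "insert (x, y) E - {(a, b), (b, a)} = insert (x, y) (E - {(a, b), (b, a)})"
      "insert (y, x) E - {(a, b), (b, a)} = insert (y, x) (E - {(a, b), (b, a)})" by auto
    then show ?thesis using linked[of x y] by simp
  qed
  have "forest_rel (insert (y, x) E) \<longleftrightarrow> forest_rel (insert (x, y) E)"
    unfolding forest_rel_def del using linked_sym[of x y] linked_sym[of y x]
    by (auto simp: insert_commute)
  moreover have "irrefl (insert (y, x) E) \<longleftrightarrow> irrefl (insert (x, y) E)"
    by (auto simp: irrefl_def)
  ultimately show "chrom_data V (insert (x, y) E) \<alpha> \<beta> \<Longrightarrow> chrom_data V (insert (y, x) E) \<alpha> \<beta>"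
    unfolding chrom_data_def by (simp only: wchrom_flip[of V _ y x E]) blast
qed

text \<open>Induction on the number of vertices plus arcs. Let \<open>v\<close> be attached by an
  arc \<open>e\<close> to a connected \<open>U\<close> that misses only \<open>v\<close>. If
  \<open>E\<close> is just \<open>e\<close> and arcs inside \<open>U\<close>, then \<open>v\<close>
  is removed as a leaf. Any other arc can be deleted without disconnecting \<open>V\<close>: either
  its reverse remains, or its ends are still linked and deletion-contraction applies.\<close>

theorem chrom_data_exists:
  assumes "finite V" "V \<noteq> {}" "E \<subseteq> V \<times> V" "connected_on V E"
  shows "\<exists>\<alpha> \<beta>. chrom_data V E \<alpha> \<beta>"
  using assms
proof (induction "card V + card E" arbitrary: V E rule: less_induct)
  case less
  have finE: "finite E" using less.prems(1,3) by (meson finite_SigmaI finite_subset)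
  show ?case
  proof (cases "irrefl E")
    case False
    then obtain x where "(x, x) \<in> E" by (auto simp: irrefl_def)
    from chrom_data_loop[OF this] show ?thesis by blast
  next
    case irr: True
    show ?thesis
    proof (cases "card V = 1")
      case True
      then obtain v where V: "V = {v}" by (meson card_1_singletonE)
      then have "E = {}" using less.prems(3) irr by (auto simp: irrefl_def)
      then show ?thesis using chrom_data_single[of v] unfolding V by blast
    next
      case False
      then have "card V \<ge> 2" using less.prems(1,2) by (simp add: Suc_le_eq card_gt_0_iff numeral_2_eq_2 le_neq_implies_less)
      then obtain U u v where U: "V = insert v U" "v \<notin> U" "u \<in> U" "(u, v) \<in> E \<or> (v, u) \<in> E"
          "connected_on U (E \<inter> U \<times> U)"
        using connected_on_leaf less.prems by metis
      let ?F = "E \<inter> U \<times> U"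
      obtain e where e: "e \<in> E" "e = (u, v) \<or> e = (v, u)" using U(4) by blast
      \<comment> \<open>The arc \<open>e\<close> and the arcs inside \<open>U\<close> suffice to
        connect \<open>V\<close>, which makes every further arc dispensable.\<close>
      have conn: "connected_on V (insert e ?F)"
        unfolding U(1) using U e
        by (intro connected_on_insert[of _ _ u] connected_on_mono[OF U(5)]) auto
      show ?thesis
      proof (cases "E = insert e ?F")
        case True
        have "finite U" "card ?F \<le> card E" "card U < card V"
          using U less.prems(1) finE by (auto intro: card_mono)
        then obtain \<alpha> \<beta> where data: "chrom_data U ?F \<alpha> \<beta>"
          using less.hyps[of U ?F] U by auto
        have "chrom_data (insert v U) (insert (u, v) ?F) \<alpha> (2 * \<beta>)"
          using U \<open>finite U\<close> data by (intro chrom_data_leaf) auto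
        then have "chrom_data V (insert e ?F) \<alpha> (2 * \<beta>)"
          unfolding U(1) using e(2) chrom_data_flip by metis
        then show ?thesis using True by auto
      next
        case False
        then obtain x y where xy: "(x, y) \<in> E" "(x, y) \<notin> insert e ?F" using e by auto
        define E' where "E' = E - {(x, y)}"
        have E: "E = insert (x, y) E'" "(x, y) \<notin> E'" using xy by (auto simp: E'_def)
        have E': "E' \<subseteq> V \<times> V" "card E' < card E"
          using less.prems(3) card_Diff1_less[OF finE xy(1)] by (auto simp: E'_def simp del: card_Diff_insert)
        have conn': "connected_on V E'"
          by (rule connected_on_mono[OF conn]) (use e xy in \<open>auto simp: E'_def\<close>)
        have V: "x \<in> V" "y \<in> V" "x \<noteq> y" using xy less.prems(3) irr by (auto simp: irrefl_def)
        obtain \<alpha> \<beta> where data: "chrom_data V E' \<alpha> \<beta>"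
          using less.hyps[of V E'] E' conn' less.prems by auto
        show ?thesis
        proof (cases "(y, x) \<in> E'")
          case True
          then show ?thesis using chrom_data_both[OF data] E by auto
        next
          case False
          have card: "card (contract x y E') \<le> card E'"
            unfolding contract_def using finE by (intro card_image_le) (simp add: E'_def)
          have "card (V - {y}) < card V"
            using V less.prems(1) by (intro card_Diff1_less)
          with card E'(2) have "card (V - {y}) + card (contract x y E') < card V + card E" by linarith
          moreover have "V - {y} \<noteq> {}" using V by blast
          moreover have "contract x y E' \<subseteq> (V - {y}) \<times> (V - {y})"
            using E'(1) V by (auto simp: contract_def split: if_splits)
          ultimately obtain \<alpha>' \<beta>' where "chrom_data (V - {y}) (contract x y E') \<alpha>' \<beta>'"
            using less.hyps[of "V - {y}" "contract x y E'"] less.prems(1)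
              connected_on_contract[OF conn' V] by blast
          \<comment> \<open>The reverse arc is absent from \<open>E'\<close>, so subtracting it
            changes nothing.\<close>
          moreover have "(x, y) \<in> linked (E' - {(y, x)})"
            using conn' V False by (auto simp: connected_on_def)
          ultimately show ?thesis
            using chrom_data_nonbridge[OF less.prems(1) V E'(1) _ E(2) data] E(1) by auto
        qed
      qed
    qed
  qed
qed

section \<open>Trees are maximal\<close>

lemma chrom_sym_eq_wchrom:
  assumes "finite (pverts G)"
  shows "chrom_sym G = wchrom (pverts G) (\<lambda>_. 1) (parcs G)"
proof -
  have "image_mset \<kappa> (mset_set V) = (\<Sum>v\<in>V. {#\<kappa> v#})" if "finite V" for \<kappa> :: "'a \<Rightarrow> nat" and V
    using that by (induction V) auto
  then show ?thesis
    using assms by (simp add: chrom_sym_def wchrom_def wcolorings_def proper_colorings_def conj_assoc)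
qed

text \<open>Library connectedness is strong connectedness of the symmetric closure, and reachability
  there implies \<open>linked\<close>.\<close>

lemma connected_on_parcs:
  assumes "Digraph_Component.connected (with_proj G)"
  shows "pverts G \<noteq> {}" "connected_on (pverts G) (parcs G)"
proof -
  let ?S = "with_proj (mk_symmetric (with_proj G))"
  have "parcs (mk_symmetric (with_proj G)) = parcs G \<union> (parcs G)\<inverse>"
    by (auto simp: parcs_mk_symmetric)
  then have "(u, v) \<in> linked (parcs G)" if "u \<rightarrow>\<^sup>*\<^bsub>?S\<^esub> v" for u v
    using rtrancl_on_rtranclI[OF that[unfolded reachable_def]] by (simp add: linked_def)
  then show "pverts G \<noteq> {}" "connected_on (pverts G) (parcs G)"
    using assms by (auto simp: connected_def strongly_connected_def connected_on_def)
qed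

text \<open>Library walks are lists of arcs. Keeping \<open>set p \<subseteq> R\<close> later shows
  that the walk avoids a removed edge.\<close>

lemma pcas_rtrancl:
  assumes "(x, y) \<in> R\<^sup>*"
  shows "\<exists>p. set p \<subseteq> R \<and> pcas x p y"
  using assms
proof (induction rule: converse_rtrancl_induct)
  case base
  show ?case by (intro exI[of _ "[]"]) simp
next
  case (step u v)
  from step.IH obtain p where "set p \<subseteq> R" "pcas v p y" by (elim exE conjE)
  with step.hyps(1) show ?case by (intro exI[of _ "(u, v) # p"]) simp
qed

text \<open>If the ends of an edge stayed linked after its removal, a path between them would close
  up with the edge to a cycle.\<close>

lemma forest_rel_tree:
  assumes T: "is_tree T"
  shows "forest_rel (parcs T)"
  unfolding forest_rel_def
proof clarify
  fix x y
  let ?E = "parcs T - {(x, y), (y, x)}"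
  assume xy: "(x, y) \<in> parcs T" and link: "(x, y) \<in> linked ?E"
  interpret pair_graph T using T by (simp add: is_tree_def)
  \<comment> \<open>Both arcs of the edge are removed, so the rest is symmetric and the link is a
    directed path.\<close>
  have "?E\<inverse> = ?E" by (auto intro: arcs_symmetric)
  then have "(x, y) \<in> ?E\<^sup>*" using link unfolding linked_def by (metis Un_absorb)
  from pcas_rtrancl[OF this] obtain p where p: "set p \<subseteq> ?E" "pcas x p y" by (elim exE conjE)
  then have walk: "awalk x p y" using in_arcsD1[OF xy] by (auto simp: awalk_def)
  define q where "q = awalk_to_apath p"
  have q: "apath x q y" "set q \<subseteq> ?E"
    using apath_awalk_to_apath[OF walk] awalk_to_apath_subset[OF walk] p(1) by (auto simp: q_def)
  have yx: "(y, x) \<in> parcs T" using xy by (rule arcs_symmetric)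
  have "x \<noteq> y" using pair_no_loops[OF xy] by simp
  \<comment> \<open>The path is nonempty as \<open>x \<noteq> y\<close>, and it is not a single arc,
    since that arc would be the removed \<open>(x, y)\<close>.\<close>
  have "length ((y, x) # q) \<ge> 3"
  proof (cases q)
    case Nil
    then show ?thesis using q(1) \<open>x \<noteq> y\<close> by (simp add: apath_def awalk_def)
  next
    case (Cons e r)
    then show ?thesis using q by (cases r; cases e) (auto simp: apath_def awalk_def)
  qed
  moreover have "cycle ((y, x) # q)"
    unfolding cycle_def using q(1) yx in_arcsD1[OF yx]
    by (intro exI[of _ y]) (auto simp: apath_def awalk_def)
  ultimately show False using T by (auto simp: is_tree_def)
qed

text \<open>With all weights 1, the total weight and the number of vertices are both
  \<open>n\<close>, and the sign \<open>(- 1) ^ (n + n)\<close> disappears.\<close>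

lemma connected_graphs_data:
  assumes "G \<in> connected_graphs n"
  obtains \<alpha> \<beta> where "n \<noteq> 0" "\<alpha> \<ge> 1" "\<beta> \<le> 2 ^ (n - 1) * \<alpha>"
    "is_tree G \<Longrightarrow> \<beta> = 2 ^ (n - 1) * \<alpha>" "e_span n (chrom_sym G) \<beta> 0 (of_nat n * \<alpha>)"
proof -
  interpret pair_graph G using assms by (simp add: connected_graphs_def)
  have conn: "Digraph_Component.connected (with_proj G)" and n: "card (pverts G) = n"
    using assms by (auto simp: connected_graphs_def)
  have "parcs G \<subseteq> pverts G \<times> pverts G" using in_arcsD1 in_arcsD2 by auto
  from chrom_data_exists[OF pair_finite_verts connected_on_parcs(1)[OF conn] this connected_on_parcs(2)[OF conn]]
  obtain \<alpha> \<beta> where data: "chrom_data (pverts G) (parcs G) \<alpha> \<beta>" by blast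
  have "n \<noteq> 0" using n connected_on_parcs(1)[OF conn] pair_finite_verts by auto
  moreover have "irrefl (parcs G)" using pair_no_loops by (fastforce simp: irrefl_def)
  moreover have "(- 1) ^ (n + n) = (1 :: rat)" by (simp flip: mult_2)
  then have "e_span n (chrom_sym G) \<beta> 0 (of_nat n * \<alpha>)"
    using chrom_data_span[OF data \<open>n \<noteq> 0\<close>, of "\<lambda>_. 1"] n
    by (simp add: chrom_sym_eq_wchrom[OF pair_finite_verts])
  ultimately show ?thesis
    using that[of \<alpha> \<beta>] data n forest_rel_tree[of G] by (simp add: chrom_data_def)
qed

section \<open>Comparison of a connected graph with a tree\<close>

lemma e_coeff_span: "e_span n F s z a \<Longrightarrow> e_coeff {#n#} F = a"
  by (metis e_coeff_eq e_span_expansion)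

lemma e_positive_span_nonpos:
  assumes "e_span n F s z a" "e_positive F" "s \<le> 0"
  shows "F = 0"
proof -
  obtain c where c: "e_expansion F c" "s = (\<Sum>la | c la \<noteq> 0. c la)"
    using e_span_expansion[OF assms(1)] by metis
  have fin: "finite {la. c la \<noteq> 0}" and part: "\<And>la. c la \<noteq> 0 \<Longrightarrow> is_partition la"
    using c(1) by (auto simp: e_expansion_def)
  \<comment> \<open>Positivity speaks of partitions only; at other multisets \<open>c\<close> is
    0.\<close>
  then have nonneg: "c la \<ge> 0" for la
    using assms(2) e_coeff_eq[OF c(1)] unfolding e_positive_def by (metis order.refl)
  then have "s = 0" using assms(3) c(2) by (metis order.antisym sum_nonneg)
  then have "{la. c la \<noteq> 0} = {}"
    using c(2) sum_nonneg_eq_0_iff[OF fin, of c] nonneg by auto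
  then show ?thesis using c(1) by (simp add: e_expansion_def)
qed

lemma e_positive_0: "e_positive 0"
proof -
  have "e_expansion 0 (\<lambda>_. 0)" by (simp add: e_expansion_def)
  from e_coeff_eq[OF this] show ?thesis by (simp add: e_positive_def)
qed

lemma X_e_tree_symmetric:
  assumes T: "T \<in> connected_graphs n" "is_tree T" and G: "G \<in> connected_graphs n"
    and pos: "e_positive (X_e G T)"
  shows "X_e T G = 0"
proof -
  obtain \<alpha> \<beta> where G': "n \<noteq> 0" "\<alpha> \<ge> 1" "\<beta> \<le> 2 ^ (n - 1) * \<alpha>" "e_span n (chrom_sym G) \<beta> 0 (of_nat n * \<alpha>)"
    using connected_graphs_data[OF G] by metis
  obtain \<alpha>' \<beta>' where T': "\<alpha>' \<ge> 1" "\<beta>' = 2 ^ (n - 1) * \<alpha>'" "e_span n (chrom_sym T) \<beta>' 0 (of_nat n * \<alpha>')"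
    using connected_graphs_data[OF T(1)] T(2) by metis
  have card: "card (pverts T) = n" "card (pverts G) = n"
    using T G by (auto simp: connected_graphs_def)
  \<comment> \<open>The common factor \<open>n\<close> cancels in the quotient of the
    coefficients.\<close>
  have X: "X_e G T = chrom_sym G - series_scale (\<alpha> / \<alpha>') (chrom_sym T)"
    "X_e T G = chrom_sym T - series_scale (\<alpha>' / \<alpha>) (chrom_sym G)"
    using G'(1) by (auto simp: X_e_def card e_coeff_span[OF G'(4)] e_coeff_span[OF T'(3)])
  \<comment> \<open>This is the sum of the coefficients of \<open>X_e G T\<close>. As the tree
    attains equality, it is \<open>\<beta> - 2 ^ (n - 1) * \<alpha>\<close>.\<close>
  have "\<beta> - \<alpha> / \<alpha>' * \<beta>' \<le> 0"
    using G'(3) T'(1) by (simp add: T'(2) field_simps)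
  then have "X_e G T = 0"
    using e_positive_span_nonpos[OF _ pos] e_span_diff[OF G'(4) e_span_scale[OF T'(3)]]
    unfolding X by metis
  then have "chrom_sym G = series_scale (\<alpha> / \<alpha>') (chrom_sym T)" by (simp add: X)
  then show ?thesis using G'(2) T'(1) by (simp add: X series_scale_scale)
qed

theorem proposition3p10:
  fixes T :: "'a pair_pre_digraph" and n :: nat
  assumes "is_tree T" and "card (pverts T) = n"
  shows "maximal_in (E_poset n) E_le (chrom_equiv n `` {T})"
proof -
  have T: "T \<in> connected_graphs n"
    using assms by (simp add: connected_graphs_def is_tree_def)
  then have "chrom_equiv n `` {T} \<in> E_poset n"
    unfolding E_poset_def by (rule quotientI)
  moreover have "E_le y (chrom_equiv n `` {T})"
    if "y \<in> E_poset n" "E_le (chrom_equiv n `` {T}) y \<or> E_le y (chrom_equiv n `` {T})" for y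
  proof -
    obtain G where G: "G \<in> connected_graphs n" "y = chrom_equiv n `` {G}"
      using \<open>y \<in> E_poset n\<close> unfolding E_poset_def by (rule quotientE)
    \<comment> \<open>Only the case of \<open>y\<close> above the tree needs an argument: then
      \<open>X_e T G\<close> is 0, which is e-positive.\<close>
    show ?thesis
      using that(2) X_e_tree_symmetric[OF T assms(1) G(1)] e_positive_0
      unfolding G(2) E_le_classes[OF T G(1)] E_le_classes[OF G(1) T] by auto
  qed
  ultimately show ?thesis by (auto simp: maximal_in_def)
qed

end
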